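(* For a lasso-shaped trace $t$ and a $\texttt{QPTL}_{cf}$ formula $\xi$, it is decidable whether $t\models\xi$, provided the similarity relation belongs to the family $\leq^{\texttt{QPTL}}$ and the universe is defined by a $\texttt{QPTL}$ formula.
   Context: Traces are infinite words $t\in(2^{AP})^\omega$ over a finite set $AP$. A trace is lasso-shaped if it has the form $t_0\ldots t_i(t_{i+1}\ldots t_j)^\omega$. LTL: $\varphi ::= a\mid\neg\varphi\mid\varphi\wedge\varphi\mid\mathsf{X}\varphi\mid\varphi\mathsf{U}\varphi$ with standard semantics, $t\models\varphi$ iff $t,0\models\varphi$. QPTL: $\psi::=\exists q.\psi\mid\forall q.\psi\mid\varphi$ ($\varphi$ LTL, $q$ fresh), where $t\models\exists q.\psi$ iff some $t_q\in(2^{\{q\}})^\omega$ gives $t[q\mapsto t_q]\models\psi$ ($\forall$ dually), $t[q\mapsto t_q]$ agreeing with $t_q$ on $q$ and with $t$ elsewhere. $\mathcal{L}(\varphi)$ is the set of traces satisfying $\varphi$. $\texttt{QPTL}_{cf}$: $\xi::=\psi\rightsquigarrow\psi\mid\psi\rightsquigarrow_{\min}\psi\mid\xi\wedge\xi\mid\neg\xi\mid\psi$ with $\psi$ QPTL and $\rightsquigarrow\in\{\Box\!\!\to,\Diamond\!\!\to,\Box\!\!\to_\forall,\Diamond\!\!\to_\exists\}$. Worlds are traces, universe $\mathcal{U}=\mathcal{L}(\varphi_\mathcal{U})$ for a QPTL formula $\varphi_\mathcal{U}$, quantifiers below range over $\mathcal{U}$, and for each reference trace $W$ there is a preorder $\leq_W$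 on $\mathcal{U}$ with minimum $W$. `Would' $W\models\varphi\Box\!\!\to\psi$ iff $\forall W_1.W_1\not\models\varphi$ or $\exists W_1.W_1\models\varphi\wedge\forall W_2.(W_2\leq_W W_1\Rightarrow W_2\models\varphi\to\psi)$; `Might' $W\models\varphi\Diamond\!\!\to\psi$ iff $\exists W_1.W_1\models\varphi$ and $\forall W_1.(W_1\models\varphi\Rightarrow\exists W_2.W_2\leq_W W_1\wedge W_2\models\varphi\wedge\psi)$; `Universal Would' $W\models\varphi\Box\!\!\to_\forall\psi$ iff $\forall W_1.W_1\not\models\varphi$ or $\forall W_1.(W_1\models\varphi\Rightarrow\exists W_2.W_2\leq_W W_1\wedge W_2\models\varphi\wedge\forall W_3.(W_3\leq_W W_2\Rightarrow W_3\models\varphi\to\psi))$; `Existential Might' $W\models\varphi\Diamond\!\!\to_\exists\psi$ iff $\exists W_1.W_1\models\varphi\wedge\forall W_2.(W_2\leq_W W_1\wedge W_2\models\varphi\Rightarrow\exists W_3.W_3\leq_W W_2\wedge W_3\models\varphi\wedge\psi)$; minimal version: $W\models\varphi\rightsquigarrow_{\min}\psi$ iff $W\models\varphi\rightsquigarrow\psi$ and there is no property $\varphi'$ with $\varphi\to\varphi'$, $\varphi'\not\to\varphi$, and $W\models\varphi'\rightsquigarrow\psi$. Boolean combinations and plain QPTL subformulas are evaluated on the trace itself. The family $\leq^{\texttt{QPTL}}$: ternary relations $R$ on traces ($R(t_1,t_2,t_3)$ meaning $t_2\leq_{t_1}t_3$) for which there is a QPTL formula $\varphi_R$ over $\{a_{\pi_j}\mid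 a\in AP,j\in\{1,2,3\}\}$ with $R(t_1,t_2,t_3)$ iff $t_1\dot\cup t_2\dot\cup t_3\models\varphi_R$, where $(t_1\dot\cup t_2\dot\cup t_3)[n]=\{a_{\pi_j}\mid a\in t_j[n]\}$. *)

theory Defs
  imports Main "HOL-Library.Nat_Bijection"
begin

section \<open>Traces, LTL and QPTL\<close>

type_synonym 'a trace = "nat \<Rightarrow> 'a set"

definition traces :: "'a set \<Rightarrow> 'a trace set" where
  "traces AP = {t. \<forall>n. t n \<subseteq> AP}"

definition lasso :: "'a set list \<Rightarrow> 'a set list \<Rightarrow> 'a trace" where
  "lasso u v n = (if n < length u then u ! n else v ! ((n - length u) mod length v))"

datatype 'a ltl =
    Atom 'a
  | Neg "'a ltl"
  | Conj "'a ltl" "'a ltl"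
  | Next "'a ltl"
  | Until "'a ltl" "'a ltl"

primrec ltl_sat :: "'a trace \<Rightarrow> nat \<Rightarrow> 'a ltl \<Rightarrow> bool" where
  "ltl_sat t i (Atom a) \<longleftrightarrow> a \<in> t i"
| "ltl_sat t i (Neg \<phi>) \<longleftrightarrow> \<not> ltl_sat t i \<phi>"
| "ltl_sat t i (Conj \<phi> \<psi>) \<longleftrightarrow> ltl_sat t i \<phi> \<and> ltl_sat t i \<psi>"
| "ltl_sat t i (Next \<phi>) \<longleftrightarrow> ltl_sat t (Suc i) \<phi>"
| "ltl_sat t i (Until \<phi> \<psi>) \<longleftrightarrow>
     (\<exists>k\<ge>i. ltl_sat t k \<psi> \<and> (\<forall>j. i \<le> j \<and> j < k \<longrightarrow> ltl_sat t j \<phi>))"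

datatype 'a qptl =
    Exists 'a "'a qptl"
  | Forall 'a "'a qptl"
  | LTL "'a ltl"

definition trace_upd :: "'a trace \<Rightarrow> 'a \<Rightarrow> 'a trace \<Rightarrow> 'a trace" where
  "trace_upd t q tq n = (t n - {q}) \<union> (tq n \<inter> {q})"

primrec qptl_sat :: "'a trace \<Rightarrow> 'a qptl \<Rightarrow> bool" where
  "qptl_sat t (Exists q \<psi>) \<longleftrightarrow> (\<exists>tq \<in> traces {q}. qptl_sat (trace_upd t q tq) \<psi>)"
| "qptl_sat t (Forall q \<psi>) \<longleftrightarrow> (\<forall>tq \<in> traces {q}. qptl_sat (trace_upd t q tq) \<psi>)"
| "qptl_sat t (LTL \<phi>) \<longleftrightarrow> ltl_sat t 0 \<phi>"

text \<open>Well-formedness over a set of propositions: free propositions belong to the set, and every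
  quantified proposition is fresh, i.e. neither in the set nor bound further outside.\<close>

primrec qptl_over :: "'a set \<Rightarrow> 'a qptl \<Rightarrow> bool" where
  "qptl_over A (Exists q \<psi>) \<longleftrightarrow> q \<notin> A \<and> qptl_over (insert q A) \<psi>"
| "qptl_over A (Forall q \<psi>) \<longleftrightarrow> q \<notin> A \<and> qptl_over (insert q A) \<psi>"
| "qptl_over A (LTL \<phi>) \<longleftrightarrow> set_ltl \<phi> \<subseteq> A"

definition language :: "'a set \<Rightarrow> 'a qptl \<Rightarrow> 'a trace set" where
  "language AP \<phi> = {t \<in> traces AP. qptl_sat t \<phi>}"


section \<open>Counterfactuals\<close>

datatype cf_op = Would | Might | Universal_Would | Existential_Might

text \<open>The relation \<open>le\<close> is the similarity relation of the reference world, \<open>U\<close> is the universe,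
  and properties are predicates on worlds.\<close>

fun cf_holds :: "'w set \<Rightarrow> ('w \<Rightarrow> 'w \<Rightarrow> bool) \<Rightarrow> cf_op \<Rightarrow> ('w \<Rightarrow> bool) \<Rightarrow> ('w \<Rightarrow> bool) \<Rightarrow> bool" where
  "cf_holds U le Would \<phi> \<psi> \<longleftrightarrow>
     (\<forall>W1\<in>U. \<not> \<phi> W1) \<or>
     (\<exists>W1\<in>U. \<phi> W1 \<and> (\<forall>W2\<in>U. le W2 W1 \<longrightarrow> \<phi> W2 \<longrightarrow> \<psi> W2))"
| "cf_holds U le Might \<phi> \<psi> \<longleftrightarrow>
     (\<exists>W1\<in>U. \<phi> W1) \<and>
     (\<forall>W1\<in>U. \<phi> W1 \<longrightarrow> (\<exists>W2\<in>U. le W2 W1 \<and> \<phi> W2 \<and> \<psi> W2))"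
| "cf_holds U le Universal_Would \<phi> \<psi> \<longleftrightarrow>
     (\<forall>W1\<in>U. \<not> \<phi> W1) \<or>
     (\<forall>W1\<in>U. \<phi> W1 \<longrightarrow>
        (\<exists>W2\<in>U. le W2 W1 \<and> \<phi> W2 \<and> (\<forall>W3\<in>U. le W3 W2 \<longrightarrow> \<phi> W3 \<longrightarrow> \<psi> W3)))"
| "cf_holds U le Existential_Might \<phi> \<psi> \<longleftrightarrow>
     (\<exists>W1\<in>U. \<phi> W1 \<and>
        (\<forall>W2\<in>U. le W2 W1 \<and> \<phi> W2 \<longrightarrow> (\<exists>W3\<in>U. le W3 W2 \<and> \<phi> W3 \<and> \<psi> W3)))"

text \<open>Implication between properties is implication at all worlds of the universe.\<close>

definition cf_min_holds ::
  "'w set \<Rightarrow> ('w \<Rightarrow> 'w \<Rightarrow> bool) \<Rightarrow> cf_op \<Rightarrow> ('w \<Rightarrow> bool) \<Rightarrow> ('w \<Rightarrow> bool) \<Rightarrow> bool" where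
  "cf_min_holds U le c \<phi> \<psi> \<longleftrightarrow>
     cf_holds U le c \<phi> \<psi> \<and>
     \<not> (\<exists>\<phi>'. (\<forall>W\<in>U. \<phi> W \<longrightarrow> \<phi>' W) \<and> \<not> (\<forall>W\<in>U. \<phi>' W \<longrightarrow> \<phi> W) \<and> cf_holds U le c \<phi>' \<psi>)"

datatype 'a qptl_cf =
    Cf cf_op "'a qptl" "'a qptl"
  | Cf_Min cf_op "'a qptl" "'a qptl"
  | Cf_And "'a qptl_cf" "'a qptl_cf"
  | Cf_Not "'a qptl_cf"
  | QPTL "'a qptl"

primrec cf_over :: "'a set \<Rightarrow> 'a qptl_cf \<Rightarrow> bool" where
  "cf_over A (Cf c \<phi> \<psi>) \<longleftrightarrow> qptl_over A \<phi> \<and> qptl_over A \<psi>"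
| "cf_over A (Cf_Min c \<phi> \<psi>) \<longleftrightarrow> qptl_over A \<phi> \<and> qptl_over A \<psi>"
| "cf_over A (Cf_And \<xi> \<zeta>) \<longleftrightarrow> cf_over A \<xi> \<and> cf_over A \<zeta>"
| "cf_over A (Cf_Not \<xi>) \<longleftrightarrow> cf_over A \<xi>"
| "cf_over A (QPTL \<psi>) \<longleftrightarrow> qptl_over A \<psi>"

text \<open>\<open>R W x y\<close> means that \<open>x\<close> is at least as similar to \<open>W\<close> as \<open>y\<close> is.\<close>

primrec cf_sat ::
  "'a trace set \<Rightarrow> ('a trace \<Rightarrow> 'a trace \<Rightarrow> 'a trace \<Rightarrow> bool) \<Rightarrow> 'a trace \<Rightarrow> 'a qptl_cf \<Rightarrow> bool" where
  "cf_sat U R W (Cf c \<phi> \<psi>) \<longleftrightarrow>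
     cf_holds U (R W) c (\<lambda>t. qptl_sat t \<phi>) (\<lambda>t. qptl_sat t \<psi>)"
| "cf_sat U R W (Cf_Min c \<phi> \<psi>) \<longleftrightarrow>
     cf_min_holds U (R W) c (\<lambda>t. qptl_sat t \<phi>) (\<lambda>t. qptl_sat t \<psi>)"
| "cf_sat U R W (Cf_And \<xi> \<zeta>) \<longleftrightarrow> cf_sat U R W \<xi> \<and> cf_sat U R W \<zeta>"
| "cf_sat U R W (Cf_Not \<xi>) \<longleftrightarrow> \<not> cf_sat U R W \<xi>"
| "cf_sat U R W (QPTL \<psi>) \<longleftrightarrow> qptl_sat W \<psi>"

definition preorder_with_minimum :: "'w set \<Rightarrow> ('w \<Rightarrow> 'w \<Rightarrow> bool) \<Rightarrow> 'w \<Rightarrow> bool" where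
  "preorder_with_minimum U le W \<longleftrightarrow>
     reflp_on U le \<and> transp_on U le \<and> W \<in> U \<and> (\<forall>x\<in>U. le W x)"

text \<open>The pair \<open>(a, j)\<close> stands for the indexed proposition $a_{\pi_j}$; all remaining pairs of natural
  numbers are available as fresh propositions for the quantifiers of the defining formula.\<close>

definition trace_union3 :: "'a trace \<Rightarrow> 'a trace \<Rightarrow> 'a trace \<Rightarrow> ('a \<times> nat) trace" where
  "trace_union3 t1 t2 t3 n = t1 n \<times> {1} \<union> t2 n \<times> {2} \<union> t3 n \<times> {3}"

definition qptl_similarities ::
  "'a set \<Rightarrow> ('a trace \<Rightarrow> 'a trace \<Rightarrow> 'a trace \<Rightarrow> bool) set" where
  "qptl_similarities AP =
     {R. \<exists>\<phi>. qptl_over (AP \<times> {1, 2, 3}) \<phi> \<and>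
          (\<forall>t1\<in>traces AP. \<forall>t2\<in>traces AP. \<forall>t3\<in>traces AP.
             R t1 t2 t3 \<longleftrightarrow> qptl_sat (trace_union3 t1 t2 t3) \<phi>)}"


section \<open>Decidability\<close>

text \<open>Partial recursive functions. Primitive recursion and minimization act on the first argument.\<close>

datatype recf =
    Zero
  | Succ
  | Proj nat
  | Comp recf "recf list"
  | PrimRec recf recf
  | Mu recf

inductive rec_eval :: "recf \<Rightarrow> nat list \<Rightarrow> nat \<Rightarrow> bool" where
  zero: "rec_eval Zero xs 0"
| succ: "rec_eval Succ [x] (Suc x)"
| proj: "i < length xs \<Longrightarrow> rec_eval (Proj i) xs (xs ! i)"
| comp: "list_all2 (\<lambda>g y. rec_eval g xs y) gs ys \<Longrightarrow> rec_eval f ys z \<Longrightarrow> rec_eval (Comp f gs) xs z"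
| prim_0: "rec_eval f xs y \<Longrightarrow> rec_eval (PrimRec f g) (0 # xs) y"
| prim_Suc: "rec_eval (PrimRec f g) (n # xs) r \<Longrightarrow> rec_eval g (n # r # xs) y \<Longrightarrow>
    rec_eval (PrimRec f g) (Suc n # xs) y"
| mu: "rec_eval f (n # xs) 0 \<Longrightarrow> (\<And>m. m < n \<Longrightarrow> \<exists>y. rec_eval f (m # xs) (Suc y)) \<Longrightarrow>
    rec_eval (Mu f) xs n"

inductive_cases rec_eval_ZeroE: "rec_eval Zero xs z"
inductive_cases rec_eval_SuccE: "rec_eval Succ xs z"
inductive_cases rec_eval_ProjE: "rec_eval (Proj i) xs z"
inductive_cases rec_eval_CompE: "rec_eval (Comp f gs) xs z"
inductive_cases rec_eval_Prim0E: "rec_eval (PrimRec f g) (0 # xs) z"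
inductive_cases rec_eval_PrimSucE: "rec_eval (PrimRec f g) (Suc n # xs) z"
inductive_cases rec_eval_MuE: "rec_eval (Mu f) xs z"

lemma rec_eval_deterministic:
  "rec_eval f xs y \<Longrightarrow> rec_eval f xs z \<Longrightarrow> y = z"
proof (induction arbitrary: z rule: rec_eval.induct)
  case (comp xs gs ys f w)
  from comp.prems obtain ys' where ys': "list_all2 (\<lambda>g y. rec_eval g xs y) gs ys'" "rec_eval f ys' z"
    by (blast elim: rec_eval_CompE)
  have "ys = ys'"
    using comp.IH(1) ys'(1)
    by (auto simp: list_all2_conv_all_nth intro!: nth_equalityI)
  with comp.IH(2) ys'(2) show ?case by simp
next
  case (prim_0 f xs y g)
  from prim_0.prems have "rec_eval f xs z" by (rule rec_eval_Prim0E)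
  then show ?case by (rule prim_0.IH)
next
  case (prim_Suc f g n xs r y)
  from prim_Suc.prems obtain r' where "rec_eval (PrimRec f g) (n # xs) r'" "rec_eval g (n # r' # xs) z"
    by (blast elim: rec_eval_PrimSucE)
  with prim_Suc.IH show ?case by blast
next
  case (mu f n xs)
  from mu.prems have z: "rec_eval f (z # xs) 0" "m < z \<Longrightarrow> \<exists>y. rec_eval f (m # xs) (Suc y)" for m
    by (rule rec_eval_MuE, blast)+
  show ?case
  proof (cases n z rule: linorder_cases)
    case less
    from z(2)[OF less] obtain y where "rec_eval f (n # xs) (Suc y)" ..
    then show ?thesis using mu.IH(1)[of "Suc y"] by simp
  next
    case greater
    from mu.IH(2)[OF greater] z(1) show ?thesis by blast
  qed
qed (auto elim: rec_eval_ZeroE rec_eval_SuccE rec_eval_ProjE)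

text \<open>A decision problem consists of a set of instances, a coding of instances by natural numbers
  and a predicate. It is decidable if a recursive function maps the codes of positive instances
  to 1 and those of negative instances to 0.\<close>

definition decidable :: "'i set \<Rightarrow> ('i \<Rightarrow> nat) \<Rightarrow> ('i \<Rightarrow> bool) \<Rightarrow> bool" where
  "decidable I code P \<longleftrightarrow> (\<exists>f. \<forall>x\<in>I. rec_eval f [code x] (if P x then 1 else 0))"

primrec ltl_code :: "nat ltl \<Rightarrow> nat" where
  "ltl_code (Atom a) = prod_encode (0, a)"
| "ltl_code (Neg \<phi>) = prod_encode (1, ltl_code \<phi>)"
| "ltl_code (Conj \<phi> \<psi>) = prod_encode (2, prod_encode (ltl_code \<phi>, ltl_code \<psi>))"
| "ltl_code (Next \<phi>) = prod_encode (3, ltl_code \<phi>)"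
| "ltl_code (Until \<phi> \<psi>) = prod_encode (4, prod_encode (ltl_code \<phi>, ltl_code \<psi>))"

primrec qptl_code :: "nat qptl \<Rightarrow> nat" where
  "qptl_code (Exists q \<psi>) = prod_encode (0, prod_encode (q, qptl_code \<psi>))"
| "qptl_code (Forall q \<psi>) = prod_encode (1, prod_encode (q, qptl_code \<psi>))"
| "qptl_code (LTL \<phi>) = prod_encode (2, ltl_code \<phi>)"

primrec cf_op_code :: "cf_op \<Rightarrow> nat" where
  "cf_op_code Would = 0"
| "cf_op_code Might = 1"
| "cf_op_code Universal_Would = 2"
| "cf_op_code Existential_Might = 3"

primrec cf_code :: "nat qptl_cf \<Rightarrow> nat" where
  "cf_code (Cf c \<phi> \<psi>) =
     prod_encode (0, prod_encode (cf_op_code c, prod_encode (qptl_code \<phi>, qptl_code \<psi>)))"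
| "cf_code (Cf_Min c \<phi> \<psi>) =
     prod_encode (1, prod_encode (cf_op_code c, prod_encode (qptl_code \<phi>, qptl_code \<psi>)))"
| "cf_code (Cf_And \<xi> \<zeta>) = prod_encode (2, prod_encode (cf_code \<xi>, cf_code \<zeta>))"
| "cf_code (Cf_Not \<xi>) = prod_encode (3, cf_code \<xi>)"
| "cf_code (QPTL \<psi>) = prod_encode (4, qptl_code \<psi>)"

definition word_code :: "nat set list \<Rightarrow> nat" where
  "word_code w = list_encode (map set_encode w)"

fun instance_code :: "nat set list \<times> nat set list \<times> nat qptl_cf \<Rightarrow> nat" where
  "instance_code (u, v, \<xi>) = prod_encode (word_code u, prod_encode (word_code v, cf_code \<xi>))"

lemma ltl_code_inject: "ltl_code \<phi> = ltl_code \<psi> \<longleftrightarrow> \<phi> = \<psi>"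
proof (induction \<phi> arbitrary: \<psi>)
  case (Atom a) show ?case by (cases \<psi>) auto
next
  case (Neg \<phi>) then show ?case by (cases \<psi>) auto
next
  case (Conj \<phi>1 \<phi>2) then show ?case by (cases \<psi>) auto
next
  case (Next \<phi>) then show ?case by (cases \<psi>) auto
next
  case (Until \<phi>1 \<phi>2) then show ?case by (cases \<psi>) auto
qed

lemma qptl_code_inject: "qptl_code \<phi> = qptl_code \<psi> \<longleftrightarrow> \<phi> = \<psi>"
proof (induction \<phi> arbitrary: \<psi>)
  case (Exists q \<phi>) then show ?case by (cases \<psi>) auto
next
  case (Forall q \<phi>) then show ?case by (cases \<psi>) auto
next
  case (LTL \<phi>) then show ?case by (cases \<psi>) (auto simp: ltl_code_inject)
qed

lemma cf_op_code_inject: "cf_op_code c = cf_op_code d \<longleftrightarrow> c = d"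
  by (cases c; cases d) auto

lemma cf_code_inject: "cf_code \<xi> = cf_code \<zeta> \<longleftrightarrow> \<xi> = \<zeta>"
proof (induction \<xi> arbitrary: \<zeta>)
  case (Cf c \<phi> \<psi>) show ?case by (cases \<zeta>) (auto simp: qptl_code_inject cf_op_code_inject)
next
  case (Cf_Min c \<phi> \<psi>) show ?case by (cases \<zeta>) (auto simp: qptl_code_inject cf_op_code_inject)
next
  case (Cf_And \<xi>1 \<xi>2) then show ?case by (cases \<zeta>) auto
next
  case (Cf_Not \<xi>) then show ?case by (cases \<zeta>) auto
next
  case (QPTL \<psi>) show ?case by (cases \<zeta>) (auto simp: qptl_code_inject)
qed

lemma word_code_inject:
  assumes "\<forall>A\<in>set u. finite A" "\<forall>A\<in>set v. finite A"
  shows "word_code u = word_code v \<longleftrightarrow> u = v"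
proof -
  have "inj_on set_encode (set u \<union> set v)"
    using assms by (intro inj_on_subset[OF inj_on_set_encode]) auto
  then show ?thesis
    unfolding word_code_def by (metis inj_on_map_eq_map list_encode_eq)
qed

text \<open>The lasso-shaped traces of the universe are given by their prefix and their period.\<close>

definition trace_checking_instances ::
  "nat set \<Rightarrow> nat trace set \<Rightarrow> (nat set list \<times> nat set list \<times> nat qptl_cf) set" where
  "trace_checking_instances AP U =
     {(u, v, \<xi>). set u \<subseteq> Pow AP \<and> set v \<subseteq> Pow AP \<and> v \<noteq> [] \<and> lasso u v \<in> U \<and> cf_over AP \<xi>}"

lemma instance_code_inj:
  assumes "finite AP"
  shows "inj_on instance_code (trace_checking_instances AP U)"
proof (rule inj_onI)
  fix x y assume x: "x \<in> trace_checking_instances AP U" and y: "y \<in> trace_checking_instances AP U"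
    and eq: "instance_code x = instance_code y"
  obtain u v \<xi> u' v' \<xi>' where xy: "x = (u, v, \<xi>)" "y = (u', v', \<xi>')"
    by (metis prod_cases3)
  have fin: "\<forall>A\<in>set w. finite A" if "set w \<subseteq> Pow AP" for w
    using that assms by (meson PowD finite_subset subsetD)
  have sub: "set u \<subseteq> Pow AP" "set v \<subseteq> Pow AP" "set u' \<subseteq> Pow AP" "set v' \<subseteq> Pow AP"
    using x y unfolding xy trace_checking_instances_def by simp_all
  have "word_code u = word_code u'" "word_code v = word_code v'" "cf_code \<xi> = cf_code \<xi>'"
    using eq unfolding xy by simp_all
  then show "x = y"
    unfolding xy using word_code_inject[OF fin[OF sub(1)] fin[OF sub(3)]]
      word_code_inject[OF fin[OF sub(2)] fin[OF sub(4)]] cf_code_inject by simp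
qed

end

theory Submission
  imports Defs "HOL-Library.Ramsey"
begin

text \<open>Everything is translated into monadic second-order logic over \<open>(\<nat>, <)\<close>: a trace is a tuple of
  set variables, and a position is a singleton. The quantification over all properties in a minimal
  counterfactual disappears because it suffices to weaken the antecedent by a single world.

  The logic is decided without automata. To each formula \<open>\<phi>\<close> belongs a finite semigroup of types of
  finite words; the type of a word for \<open>\<exists>X. \<phi>\<close> is the set of \<open>\<phi>\<close>-types of its expansions by a track
  \<open>X\<close>, and negation leaves the semigroup unchanged. By Ramsey's theorem every infinite word factors
  as \<open>w\<^sub>0 w\<^sub>1 w\<^sub>2 \<dots>\<close> with types \<open>s, e, e, \<dots>\<close> where \<open>s e = s\<close> and \<open>e e = e\<close>, and the truth of \<open>\<phi>\<close> depends
  only on \<open>(s, e)\<close>: \<open>\<exists>X. \<phi>\<close> accepts the pair of sets \<open>(S, E)\<close> iff \<open>\<phi>\<close> accepts some such pair in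
  \<open>S \<times> E\<close>. Types are coded by numbers, so products and acceptance are recursive. For a lasso, an
  unbounded search finds an idempotent power of the type of its period.\<close>

section \<open>Recursive functions\<close>

text \<open>The property quantified in a minimal counterfactual is an arbitrary set of traces, a
  third-order object over the natural numbers, so it has to be eliminated before any translation
  into monadic logic. Decidability means that an explicit recursive function exists, so the decision
  procedure itself must be arithmetic: types are numbers built by pairing and by binary codes of
  finite sets, and each recursion over syntax becomes a course-of-values recursion over codes. The
  number of types of a formula is never computed; the search for an idempotent replaces a bound on
  it, and Ramsey's theorem guarantees that the search ends. \<open>type_mult\<close> is defined on
  all numbers, but it is regrouped only on types of actual words, where associativity is that of
  concatenation. The propositions, the universe and the similarity relation are fixed, so their
  formulas enter the procedure as constants; only the lasso and the counterfactual formula are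
  inputs.\<close>

abbreviation pair :: "nat \<Rightarrow> nat \<Rightarrow> nat" (\<open>\<langle>_,/ _\<rangle>\<close>) where
  "\<langle>x, y\<rangle> \<equiv> prod_encode (x, y)"

definition pfst :: "nat \<Rightarrow> nat" where
  "pfst z = fst (prod_decode z)"

definition psnd :: "nat \<Rightarrow> nat" where
  "psnd z = snd (prod_decode z)"

lemma pfst_pair [simp]: "pfst \<langle>x, y\<rangle> = x"
  by (simp add: pfst_def)

lemma psnd_pair [simp]: "psnd \<langle>x, y\<rangle> = y"
  by (simp add: psnd_def)

lemma pair_collapse [simp]: "\<langle>pfst z, psnd z\<rangle> = z"
  by (simp add: pfst_def psnd_def)

text \<open>All codes on the anti-diagonal of sum k lie below \<open>triangle (Suc k)\<close>, the
  first code of the next one. Comparing sums in this way shows most recursive calls on paired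
  arguments to be decreasing.\<close>

lemma pair_less:
  assumes "m + n < m' + n'"
  shows "\<langle>m, n\<rangle> < \<langle>m', n'\<rangle>"
proof -
  have "triangle (Suc (m + n)) \<le> triangle (m' + n')"
    by (rule lift_Suc_mono_le[of triangle]) (use assms in simp_all)
  then show ?thesis
    by (simp add: prod_encode_def)
qed

lemma pair_ge: "m + n \<le> \<langle>m, n\<rangle>"
proof -
  have "k \<le> triangle k" for k
    by (induction k) simp_all
  then show ?thesis by (simp add: prod_encode_def trans_le_add1)
qed

text \<open>The bound 2 is needed because \<open>triangle\<close> fixes 0 and 1. Strictness matters
  where an outer tag 0 adds nothing to the size of a code.\<close>

lemma pair_greater: "2 \<le> m + n \<Longrightarrow> m + n < \<langle>m, n\<rangle>"
proof -
  assume "2 \<le> m + n"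
  have "k < triangle k" if "2 \<le> k" for k
    using that
  proof (induction k rule: dec_induct)
    case base show ?case by (simp add: numeral_2_eq_2)
  qed simp
  from this[OF \<open>2 \<le> m + n\<close>] show ?thesis by (simp add: prod_encode_def trans_less_add1)
qed

lemma pair_mono: "m \<le> m' \<Longrightarrow> n \<le> n' \<Longrightarrow> \<langle>m, n\<rangle> \<le> \<langle>m', n'\<rangle>"
  using pair_less[of m n m' n'] by (cases "m = m' \<and> n = n'") auto

lemma pfst_le: "pfst z \<le> z"
  using le_prod_encode_1[of "pfst z" "psnd z"] by simp

lemma psnd_le: "psnd z \<le> z"
  using le_prod_encode_2[of "psnd z" "pfst z"] by simp

lemma set_decode_power: "set_decode (2 ^ x) = {x}"
  using set_encode_inverse[of "{x}"] by simp

lemma set_decode_less: "a \<in> set_decode s \<Longrightarrow> a < s"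
proof -
  assume "a \<in> set_decode s"
  then have "2 ^ a \<le> s"
    by (intro subset_decode_imp_le) (simp add: set_decode_power)
  then show ?thesis
    by (rule less_le_trans[OF less_exp])
qed

text \<open>Everything is reduced to total unary functions, with several arguments packed by
  pairing. The binary variant below is the interface to the recursion schemes, which act on the
  first of several arguments.\<close>

definition computable :: "(nat \<Rightarrow> nat) \<Rightarrow> bool" where
  "computable f \<longleftrightarrow> (\<exists>r. \<forall>x. rec_eval r [x] (f x))"

definition computable2 :: "(nat \<Rightarrow> nat \<Rightarrow> nat) \<Rightarrow> bool" where
  "computable2 f \<longleftrightarrow> (\<exists>r. \<forall>x y. rec_eval r [x, y] (f x y))"

section \<open>Composition, sums, differences and pairing\<close>

lemma rec_eval_Comp1:
  "rec_eval g xs y \<Longrightarrow> rec_eval f [y] z \<Longrightarrow> rec_eval (Comp f [g]) xs z"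
  by (rule comp[of xs "[g]" "[y]"]) simp_all

lemma rec_eval_Comp2:
  "rec_eval g xs y \<Longrightarrow> rec_eval h xs y' \<Longrightarrow> rec_eval f [y, y'] z \<Longrightarrow> rec_eval (Comp f [g, h]) xs z"
  by (rule comp[of xs "[g, h]" "[y, y']"]) simp_all

lemma rec_eval_Proj_0: "rec_eval (Proj 0) (x # xs) x"
  using proj[of 0 "x # xs"] by simp

lemma rec_eval_Proj_1: "rec_eval (Proj (Suc 0)) (x # y # xs) y"
  using proj[of "Suc 0" "x # y # xs"] by simp

lemma rec_eval_Proj_2: "rec_eval (Proj 2) (x # y # z # xs) z"
  using proj[of 2 "x # y # z # xs"] by simp

lemmas rec_eval_basic =
  rec_eval_Comp1 rec_eval_Comp2 rec_eval_Proj_0 rec_eval_Proj_1 rec_eval_Proj_2 zero succ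

lemma computable_id: "computable (\<lambda>x. x)"
  unfolding computable_def by (rule exI[of _ "Proj 0"]) (simp add: rec_eval_Proj_0)

lemma computable_comp:
  assumes "computable f" "computable g"
  shows "computable (\<lambda>x. f (g x))"
proof -
  obtain r s where rs: "rec_eval r [x] (f x)" "rec_eval s [x] (g x)" for x
    using assms unfolding computable_def by blast
  have "rec_eval (Comp r [s]) [x] (f (g x))" for x
    by (rule rec_eval_Comp1[OF rs(2) rs(1)])
  then show ?thesis unfolding computable_def by blast
qed

lemma computable_comp2:
  assumes "computable2 f" "computable g" "computable h"
  shows "computable (\<lambda>x. f (g x) (h x))"
proof -
  obtain r s t where rst: "rec_eval r [x, y] (f x y)" "rec_eval s [x] (g x)" "rec_eval t [x] (h x)" for x y
    using assms unfolding computable_def computable2_def by blast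
  have "rec_eval (Comp r [s, t]) [x] (f (g x) (h x))" for x
    by (rule rec_eval_Comp2[OF rst(2,3,1)])
  then show ?thesis unfolding computable_def by blast
qed

lemma computable_Suc: "computable f \<Longrightarrow> computable (\<lambda>x. Suc (f x))"
  by (rule computable_comp[of Suc]) (auto simp: computable_def intro!: exI[of _ Succ] succ)

lemma computable_const: "computable (\<lambda>x. c)"
proof (induction c)
  case 0
  show ?case unfolding computable_def by (rule exI[of _ Zero]) (simp add: zero)
qed (rule computable_Suc)

lemma rec_eval_add: "\<exists>r. \<forall>n x. rec_eval r [n, x] (n + x)"
proof -
  have "rec_eval (PrimRec (Proj 0) (Comp Succ [Proj (Suc 0)])) [n, x] (n + x)" for n x
  proof (induction n)
    case 0 show ?case by (simp add: prim_0 rec_eval_Proj_0 zero)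
  next
    case (Suc n)
    show ?case by (rule prim_Suc[OF Suc]) (simp, (rule rec_eval_basic)+)
  qed
  then show ?thesis by blast
qed

lemma rec_eval_pred: "\<exists>r. \<forall>n. rec_eval r [n] (n - 1)"
proof -
  have "rec_eval (PrimRec Zero (Proj 0)) [n] (n - 1)" for n
  proof (induction n)
    case 0 show ?case by (simp add: prim_0 rec_eval_Proj_0 zero)
  next
    case (Suc n)
    show ?case by (rule prim_Suc[OF Suc]) (simp, rule rec_eval_Proj_0)
  qed
  then show ?thesis by blast
qed

lemma rec_eval_diff: "\<exists>r. \<forall>n x. rec_eval r [n, x] (x - n)"
proof -
  obtain p where p: "rec_eval p [n] (n - 1)" for n
    using rec_eval_pred by blast
  have "rec_eval (PrimRec (Proj 0) (Comp p [Proj (Suc 0)])) [n, x] (x - n)" for n x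
  proof (induction n)
    case 0 show ?case by (simp add: prim_0 rec_eval_Proj_0 zero)
  next
    case (Suc n)
    have "rec_eval (Comp p [Proj (Suc 0)]) [n, x - n, x] (x - n - 1)"
      by (rule rec_eval_basic p)+
    then show ?case using prim_Suc[OF Suc] by simp
  qed
  then show ?thesis by blast
qed

lemma computable2_add: "computable2 (+)"
  using rec_eval_add by (simp add: computable2_def)

lemma computable2_diff: "computable2 (-)"
proof -
  obtain r where "rec_eval r [n, x] (x - n)" for n x
    using rec_eval_diff by blast
  then have "rec_eval (Comp r [Proj (Suc 0), Proj 0]) [x, n] (x - n)" for n x
    by (rule rec_eval_Comp2[OF rec_eval_Proj_1 rec_eval_Proj_0])
  then show ?thesis unfolding computable2_def by blast
qed

lemma computable_triangle: "computable triangle"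
proof -
  obtain a where a: "rec_eval a [n, x] (n + x)" for n x
    using rec_eval_add by blast
  have "rec_eval (PrimRec Zero (Comp a [Proj (Suc 0), Comp Succ [Proj 0]])) [n] (triangle n)" for n
  proof (induction n)
    case 0 show ?case by (simp add: prim_0 rec_eval_Proj_0 zero)
  next
    case (Suc n)
    show ?case by (rule prim_Suc[OF Suc]) (simp only: triangle_Suc, (rule rec_eval_basic a)+)
  qed
  then show ?thesis unfolding computable_def by blast
qed

text \<open>If \<open>d\<close> is the anti-diagonal of \<open>z\<close>, the code
  \<open>triangle (Suc d)\<close> opens the next one. The outer truncated difference is 1 exactly if
  \<open>Suc z\<close> has reached that code, and only then does the sum grow.\<close>

lemma diagonal_Suc:
  "pfst (Suc z) + psnd (Suc z)
   = pfst z + psnd z + (1 - (triangle (Suc (pfst z + psnd z)) - Suc z))"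
proof -
  obtain m n where z: "z = \<langle>m, n\<rangle>"
    by (metis pair_collapse)
  have "Suc z = (if n = 0 then \<langle>0, Suc m\<rangle> else \<langle>Suc m, n - 1\<rangle>)"
    by (cases n) (simp_all add: z prod_encode_def)
  moreover have "1 - (triangle (Suc (m + n)) - Suc \<langle>m, n\<rangle>) = (if n = 0 then 1 else 0)"
    by (auto simp: prod_encode_def)
  ultimately show ?thesis
    by (simp add: z del: triangle_Suc)
qed

text \<open>The anti-diagonal of \<open>z\<close> satisfies a recursion in a single value, so that unpairing needs
  no simultaneous recursion.\<close>

lemma computable_diagonal: "computable (\<lambda>z. pfst z + psnd z)"
proof -
  obtain a d t where a: "rec_eval a [n, x] (n + x)" and d: "rec_eval d [n, x] (x - n)"
    and t: "rec_eval t [n] (triangle n)" for n x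
    using rec_eval_add rec_eval_diff computable_triangle unfolding computable_def by blast
  let ?g = "Comp a [Proj (Suc 0), Comp d [Comp d [Comp Succ [Proj 0], Comp t [Comp Succ [Proj (Suc 0)]]],
      Comp Succ [Zero]]]"
  have "rec_eval (PrimRec Zero ?g) [z] (pfst z + psnd z)" for z
  proof (induction z)
    case 0
    have "pfst 0 + psnd 0 = 0"
      using pfst_pair[of 0 0] psnd_pair[of 0 0] by (simp add: prod_encode_def)
    then show ?case by (simp add: prim_0 rec_eval_Proj_0 zero)
  next
    case (Suc z)
    show ?case
      by (rule prim_Suc[OF Suc], unfold diagonal_Suc One_nat_def)
        (rule rec_eval_basic a d t)+
  qed
  then show ?thesis unfolding computable_def by blast
qed

lemma computable_add: "computable f \<Longrightarrow> computable g \<Longrightarrow> computable (\<lambda>x. f x + g x)"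
  by (rule computable_comp2[OF computable2_add])

lemma computable_diff: "computable f \<Longrightarrow> computable g \<Longrightarrow> computable (\<lambda>x. f x - g x)"
  by (rule computable_comp2[OF computable2_diff])

lemma computable_pfst_psnd: "computable pfst" "computable psnd"
proof -
  have "z - triangle (pfst z + psnd z) = pfst z" for z
    using pair_collapse[of z] unfolding prod_encode_def by simp
  moreover have "computable (\<lambda>z. z - triangle (pfst z + psnd z))"
    by (intro computable_diff computable_comp[OF computable_triangle] computable_diagonal computable_id)
  ultimately show *: "computable pfst"
    by simp
  have "computable (\<lambda>z. (pfst z + psnd z) - pfst z)"
    by (intro computable_diff computable_diagonal *)
  then show "computable psnd"
    by simp
qed

lemma computable_pfst: "computable f \<Longrightarrow> computable (\<lambda>x. pfst (f x))"
  by (rule computable_comp[OF computable_pfst_psnd(1)])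

lemma computable_psnd: "computable f \<Longrightarrow> computable (\<lambda>x. psnd (f x))"
  by (rule computable_comp[OF computable_pfst_psnd(2)])

lemma computable_pair:
  assumes "computable f" "computable g"
  shows "computable (\<lambda>x. \<langle>f x, g x\<rangle>)"
  unfolding prod_encode_def prod.case using assms
  by (intro computable_add computable_comp[OF computable_triangle])

lemma computable2_pair: "computable2 (\<lambda>x y. \<langle>x, y\<rangle>)"
proof -
  obtain a t where a: "rec_eval a [n, x] (n + x)" and t: "rec_eval t [n] (triangle n)" for n x
    using rec_eval_add computable_triangle unfolding computable_def by blast
  have "rec_eval (Comp a [Comp t [a], Proj 0]) [x, y] \<langle>x, y\<rangle>" for x y
    unfolding prod_encode_def prod.case
    by (rule rec_eval_Comp2[OF rec_eval_Comp1[OF a t] rec_eval_Proj_0 a])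
  then show ?thesis unfolding computable2_def by blast
qed

lemma computable2_uncurry:
  assumes "computable f"
  shows "computable2 (\<lambda>x y. f \<langle>x, y\<rangle>)"
proof -
  obtain p r where p: "rec_eval p [x, y] \<langle>x, y\<rangle>" and r: "rec_eval r [x] (f x)" for x y
    using computable2_pair assms unfolding computable2_def computable_def by blast
  have "rec_eval (Comp r [p]) [x, y] (f \<langle>x, y\<rangle>)" for x y
    by (rule rec_eval_Comp1[OF p r])
  then show ?thesis unfolding computable2_def by blast
qed

text \<open>The form in which primitive recursion is used below: functions are first rewritten with
  \<open>rec_nat\<close>, and number of steps, start and step may all depend on the parameter. The
  step reads counter, previous value and parameter from one nested pair, since
  \<open>computable\<close> concerns unary functions.\<close>

lemma computable_rec_nat:
  assumes b: "computable b" and g: "computable g"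
    and h: "computable (\<lambda>z. h (pfst z) (pfst (psnd z)) (psnd (psnd z)))"
  shows "computable (\<lambda>x. rec_nat (g x) (\<lambda>n r. h n r x) (b x))"
proof -
  obtain rb rg rh where r: "rec_eval rb [x] (b x)" "rec_eval rg [x] (g x)"
    "rec_eval rh [x] (h (pfst x) (pfst (psnd x)) (psnd (psnd x)))" for x
    using assms unfolding computable_def by blast
  obtain p where p: "rec_eval p [x, y] \<langle>x, y\<rangle>" for x y
    using computable2_pair unfolding computable2_def by blast
  let ?h = "Comp rh [Comp p [Proj 0, Comp p [Proj (Suc 0), Proj 2]]]"
  have h': "rec_eval ?h [n, y, x] (h n y x)" for n y x
    using r(3)[of "\<langle>n, \<langle>y, x\<rangle>\<rangle>"]
    by (auto intro!: rec_eval_Comp1 rec_eval_Comp2 p rec_eval_Proj_0 rec_eval_Proj_1 rec_eval_Proj_2)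
  have "rec_eval (PrimRec rg ?h) [n, x] (rec_nat (g x) (\<lambda>n r. h n r x) n)" for n x
  proof (induction n)
    case 0 show ?case by (simp add: prim_0 r)
  next
    case (Suc n)
    show ?case using prim_Suc[OF Suc h'] by simp
  qed
  then have "rec_eval (Comp (PrimRec rg ?h) [rb, Proj 0]) [x] (rec_nat (g x) (\<lambda>n r. h n r x) (b x))" for x
    by (rule rec_eval_Comp2[OF r(1) rec_eval_Proj_0])
  then show ?thesis unfolding computable_def by blast
qed

section \<open>Arithmetic, truth values, bounded search and coded finite sets\<close>

lemma computable_mult:
  assumes "computable f" "computable g"
  shows "computable (\<lambda>x. f x * g x)"
proof -
  have eq: "m * n = rec_nat 0 (\<lambda>_ r. r + n) m" for m n :: nat
    by (induction m) simp_all
  show ?thesis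
    unfolding eq using assms
    by (intro computable_rec_nat computable_add computable_comp[OF assms(2)] computable_pfst
        computable_psnd computable_const computable_id)
qed

lemma computable_power:
  assumes "computable f"
  shows "computable (\<lambda>x. 2 ^ f x)"
proof -
  have eq: "(2::nat) ^ m = rec_nat 1 (\<lambda>_ r. r + r) m" for m :: nat
    by (induction m) simp_all
  show ?thesis
    unfolding eq using assms
    by (intro computable_rec_nat computable_add computable_pfst computable_psnd computable_const computable_id)
qed

lemma computable_not:
  assumes "computable (\<lambda>x. of_bool (P x))"
  shows "computable (\<lambda>x. of_bool (\<not> P x))"
proof -
  have eq: "of_bool (\<not> P x) = 1 - (of_bool (P x) :: nat)" for x
    by simp
  show ?thesis
    unfolding eq using assms by (intro computable_diff computable_const)
qed

lemma computable_conj: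
  assumes "computable (\<lambda>x. of_bool (P x))" "computable (\<lambda>x. of_bool (Q x))"
  shows "computable (\<lambda>x. of_bool (P x \<and> Q x))"
  unfolding of_bool_conj using assms by (rule computable_mult)

lemma computable_less:
  assumes "computable f" "computable g"
  shows "computable (\<lambda>x. of_bool (f x < g x))"
proof -
  have eq: "of_bool (m < n) = 1 - (1 - (n - m))" for m n :: nat
    by auto
  show ?thesis
    unfolding eq using assms by (intro computable_diff computable_const)
qed

lemma computable_eq:
  assumes "computable f" "computable g"
  shows "computable (\<lambda>x. of_bool (f x = g x))"
proof -
  have eq: "(m = n) = (\<not> m < n \<and> \<not> n < m)" for m n :: nat
    by auto
  show ?thesis
    unfolding eq by (intro computable_conj computable_not computable_less assms)
qed

lemma computable_if:
  assumes "computable (\<lambda>x. of_bool (P x))" "computable f" "computable g"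
  shows "computable (\<lambda>x. if P x then f x else g x)"
proof -
  have eq: "(if P x then f x else g x) = of_bool (P x) * f x + of_bool (\<not> P x) * g x" for x
    by simp
  show ?thesis
    unfolding eq using assms by (intro computable_add computable_mult computable_not)
qed

lemma computable_max:
  assumes "computable f" "computable g"
  shows "computable (\<lambda>x. max (f x) (g x))"
  unfolding max_def not_less[symmetric] using assms by (intro computable_if computable_not computable_less)

lemma computable_min:
  assumes "computable f" "computable g"
  shows "computable (\<lambda>x. min (f x) (g x))"
  unfolding min_def not_less[symmetric] using assms by (intro computable_if computable_not computable_less)

lemma computable_bex:
  assumes "computable b" "computable (\<lambda>z. of_bool (P (pfst z) (psnd z)))"
  shows "computable (\<lambda>x. of_bool (\<exists>i<b x. P i x))"
proof -
  have eq: "of_bool (\<exists>i<n. P i x) = rec_nat (0::nat) (\<lambda>n r. if P n x then 1 else r) n" for n x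
  proof (induction n)
    case (Suc n)
    have "(\<exists>i<Suc n. P i x) \<longleftrightarrow> P n x \<or> (\<exists>i<n. P i x)"
      by (auto simp: less_Suc_eq)
    then show ?case using Suc by (cases "P n x") (simp_all del: One_nat_def)
  qed simp
  have "computable (\<lambda>z. of_bool (P (pfst z) (psnd (psnd z))))"
    using computable_comp[OF assms(2), of "\<lambda>z. \<langle>pfst z, psnd (psnd z)\<rangle>"]
    by (simp add: computable_pair computable_pfst computable_psnd computable_id)
  then show ?thesis
    unfolding eq using assms(1)
    by (intro computable_rec_nat computable_if computable_const computable_pfst computable_psnd computable_id)
qed

lemma computable_half: "computable (\<lambda>n. n div 2)"
proof -
  have "n mod 2 = rec_nat 0 (\<lambda>_ r. 1 - r) n" for n :: nat
    by (induction n) (auto simp: mod_Suc)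
  moreover have "computable (\<lambda>n. rec_nat 0 (\<lambda>_ r. 1 - r) n)"
    by (intro computable_rec_nat computable_diff computable_const computable_pfst computable_psnd computable_id)
  ultimately have m: "computable (\<lambda>n. n mod 2)" by simp
  have "n div 2 = rec_nat 0 (\<lambda>n r. r + n mod 2) n" for n :: nat
    by (induction n) (auto simp: div_Suc mod_Suc)
  moreover have "computable (\<lambda>n. rec_nat 0 (\<lambda>n r. r + n mod 2) n)"
    by (intro computable_rec_nat computable_add computable_const computable_comp[OF m]
        computable_pfst computable_psnd computable_id)
  ultimately show ?thesis by simp
qed

lemma computable_member:
  assumes "computable f" "computable g"
  shows "computable (\<lambda>x. of_bool (f x \<in> set_decode (g x)))"
proof -
  have d: "n div 2 ^ m = rec_nat n (\<lambda>_ r. r div 2) m" for m n :: nat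
  proof (induction m)
    case (Suc m)
    then show ?case by (metis div_mult2_eq old.nat.simps(7) power_Suc2)
  qed simp
  have c: "computable (\<lambda>x. g x div 2 ^ f x)"
    unfolding d using assms
    by (intro computable_rec_nat computable_comp[OF computable_half] computable_pfst computable_psnd computable_id)
  \<comment> \<open>Bit \<open>m\<close> is the parity of \<open>n div 2 ^ m\<close>; oddness is
    phrased through halving and addition, which are already computable.\<close>
  have eq: "m \<in> set_decode n \<longleftrightarrow> \<not> (n div 2 ^ m = n div 2 ^ m div 2 + n div 2 ^ m div 2)" for m n
  proof -
    have "odd k \<longleftrightarrow> \<not> (k = k div 2 + k div 2)" for k :: nat
      by presburger
    then show ?thesis unfolding set_decode_def by blast
  qed
  show ?thesis
    unfolding eq by (intro computable_not computable_eq computable_add computable_comp[OF computable_half] c)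
qed

lemma set_encode_insert_if:
  "finite A \<Longrightarrow> set_encode (insert n A) = (if n \<in> set_decode (set_encode A) then set_encode A else 2 ^ n + set_encode A)"
  by (auto simp: insert_absorb)

text \<open>The set is collected by adding powers of two. Different \<open>i\<close> may yield the
  same value, so a power is added only while its bit is still clear.\<close>

lemma computable_set_encode_Collect:
  assumes "computable b" "computable (\<lambda>z. of_bool (P (pfst z) (psnd z)))"
    "computable (\<lambda>z. f (pfst z) (psnd z))"
  shows "computable (\<lambda>x. set_encode {f i x |i. i < b x \<and> P i x})"
proof -
  let ?h = "\<lambda>n r x. if P n x then if f n x \<in> set_decode r then r else 2 ^ f n x + r else r"
  have eq: "set_encode {f i x |i. i < n \<and> P i x} = rec_nat 0 (\<lambda>n r. ?h n r x) n" for n x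
  proof (induction n)
    case (Suc n)
    have "{f i x |i. i < Suc n \<and> P i x}
        = (if P n x then insert (f n x) {f i x |i. i < n \<and> P i x} else {f i x |i. i < n \<and> P i x})"
      by (auto simp: less_Suc_eq)
    then show ?case
      using Suc by (simp add: set_encode_insert_if del: set_encode_inverse)
  qed simp
  have "computable (\<lambda>z. of_bool (P (pfst z) (psnd (psnd z))))"
    using computable_comp[OF assms(2), of "\<lambda>z. \<langle>pfst z, psnd (psnd z)\<rangle>"]
    by (simp add: computable_pair computable_pfst computable_psnd computable_id)
  moreover have "computable (\<lambda>z. f (pfst z) (psnd (psnd z)))"
    using computable_comp[OF assms(3), of "\<lambda>z. \<langle>pfst z, psnd (psnd z)\<rangle>"]
    by (simp add: computable_pair computable_pfst computable_psnd computable_id)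
  ultimately show ?thesis
    unfolding eq using assms(1)
    by (intro computable_rec_nat computable_if computable_const computable_pfst computable_psnd
        computable_member computable_add computable_power computable_id)
qed

text \<open>Course-of-values recursion: \<open>table_lookup n T y\<close> is the entry for \<open>y\<close> in the table \<open>T\<close> of the
  values at \<open>n - 1, \<dots>, 0\<close>.\<close>

definition table_lookup :: "nat \<Rightarrow> nat \<Rightarrow> nat \<Rightarrow> nat" where
  "table_lookup n T y = (if y < n then pfst ((psnd ^^ (n - Suc y)) T) else 0)"

lemma computable_table_lookup:
  assumes "computable f" "computable g" "computable h"
  shows "computable (\<lambda>x. table_lookup (f x) (g x) (h x))"
proof -
  have eq: "(psnd ^^ n) T = rec_nat T (\<lambda>_ r. psnd r) n" for n T
    by (induction n) simp_all
  show ?thesis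
    unfolding table_lookup_def eq using assms
    by (intro computable_if computable_less computable_pfst computable_psnd computable_rec_nat
        computable_diff computable_Suc computable_const computable_id)
qed

text \<open>The oracle given to \<open>H\<close> returns 0 at arguments that are not below
  \<open>x\<close>. Hence \<open>H\<close> needs no termination argument: a call must be shown
  smaller only at the codes where the result is claimed to be correct. A table is the pair of its
  newest value and the previous table, so extending it is one pairing.\<close>

lemma computable_course_of_values:
  assumes H: "computable (\<lambda>z. H (table_lookup (pfst z) (psnd z)) (pfst z))"
  obtains F where "computable F" "\<And>x. F x = H (\<lambda>y. if y < x then F y else 0) x"
proof -
  define tab where "tab n = rec_nat 0 (\<lambda>n T. \<langle>H (table_lookup n T) n, T\<rangle>) n" for n
  define F where "F n = H (table_lookup n (tab n)) n" for n
  have tab_Suc: "tab (Suc n) = \<langle>F n, tab n\<rangle>" for n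
    by (simp add: tab_def F_def)
  have psnds: "(psnd ^^ k) (tab (k + m)) = tab m" for k m
    by (induction k) (simp_all add: tab_Suc funpow_Suc_right del: funpow.simps)
  have "table_lookup n (tab n) y = (if y < n then F y else 0)" for n y
  proof (cases "y < n")
    case True
    then have "n - Suc y + Suc y = n" by simp
    then show ?thesis
      using psnds[of "n - Suc y" "Suc y"] True by (simp only: table_lookup_def tab_Suc if_True pfst_pair)
  qed (simp add: table_lookup_def)
  then have "table_lookup n (tab n) = (\<lambda>y. if y < n then F y else 0)" for n
    by blast
  then have 1: "F x = H (\<lambda>y. if y < x then F y else 0) x" for x
    by (metis F_def)
  have "computable (\<lambda>z. H (table_lookup (pfst z) (pfst (psnd z))) (pfst z))"
    using computable_comp[OF H, of "\<lambda>z. \<langle>pfst z, pfst (psnd z)\<rangle>"]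
    by (simp add: computable_pair computable_pfst computable_psnd computable_id)
  then have "computable tab"
    unfolding tab_def[abs_def]
    by (intro computable_rec_nat computable_pair computable_pfst computable_psnd computable_const computable_id)
  then have "computable F"
    unfolding F_def[abs_def] using computable_comp[OF H, of "\<lambda>n. \<langle>n, tab n\<rangle>"]
    by (simp add: computable_pair computable_id)
  with 1 show ?thesis using that by blast
qed

lemmas computable_intros = computable_const computable_id computable_Suc computable_add computable_diff
  computable_pfst computable_psnd computable_pair computable_if computable_max computable_min computable_power
  computable_not computable_conj computable_less computable_eq computable_member
  computable_bex computable_set_encode_Collect computable_table_lookup computable_rec_nat

section \<open>Monadic second-order logic and types of finite words\<close>

text \<open>Inclusion is taken negated because then both atoms assert the existence of positions. A
  finite prefix settles a positive answer, the flags of prefixes can only grow, and acceptance can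
  be read off the type of a prefix.\<close>

datatype mso =
    NotSub nat nat
  | Before nat nat
  | MNot mso
  | MAnd mso mso
  | MEx nat mso

primrec holds :: "(nat \<Rightarrow> nat set) \<Rightarrow> mso \<Rightarrow> bool" where
  "holds e (NotSub x y) \<longleftrightarrow> \<not> e x \<subseteq> e y"
| "holds e (Before x y) \<longleftrightarrow> (\<exists>i\<in>e x. \<exists>j\<in>e y. i < j)"
| "holds e (MNot \<phi>) \<longleftrightarrow> \<not> holds e \<phi>"
| "holds e (MAnd \<phi> \<psi>) \<longleftrightarrow> holds e \<phi> \<and> holds e \<psi>"
| "holds e (MEx x \<phi>) \<longleftrightarrow> (\<exists>X. holds (e(x := X)) \<phi>)"

definition tracks :: "nat trace \<Rightarrow> nat \<Rightarrow> nat set" where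
  "tracks \<alpha> x = {n. x \<in> \<alpha> n}"

definition variants :: "nat \<Rightarrow> nat set list \<Rightarrow> nat set list set" where
  "variants x w = {w'. list_all2 (\<lambda>a b. a - {x} = b - {x}) w' w}"

text \<open>For \<open>Before\<close> the occurrences of \<open>x\<close> and of \<open>y\<close>
  are recorded separately, since a pair of positions may straddle a cut.\<close>

primrec word_type :: "mso \<Rightarrow> nat set list \<Rightarrow> nat" where
  "word_type (NotSub x y) w = of_bool (\<exists>a\<in>set w. x \<in> a \<and> y \<notin> a)"
| "word_type (Before x y) w = \<langle>of_bool (\<exists>a\<in>set w. x \<in> a), \<langle>of_bool (\<exists>a\<in>set w. y \<in> a),
     of_bool (\<exists>j<length w. \<exists>i<j. x \<in> w ! i \<and> y \<in> w ! j)\<rangle>\<rangle>"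
| "word_type (MNot \<phi>) w = word_type \<phi> w"
| "word_type (MAnd \<phi> \<psi>) w = \<langle>word_type \<phi> w, word_type \<psi> w\<rangle>"
| "word_type (MEx x \<phi>) w = set_encode (word_type \<phi> ` variants x w)"

primrec letter_type :: "mso \<Rightarrow> nat set \<Rightarrow> nat" where
  "letter_type (NotSub x y) a = of_bool (x \<in> a \<and> y \<notin> a)"
| "letter_type (Before x y) a = \<langle>of_bool (x \<in> a), \<langle>of_bool (y \<in> a), 0\<rangle>\<rangle>"
| "letter_type (MNot \<phi>) a = letter_type \<phi> a"
| "letter_type (MAnd \<phi> \<psi>) a = \<langle>letter_type \<phi> a, letter_type \<psi> a\<rangle>"
| "letter_type (MEx x \<phi>) a = set_encode {letter_type \<phi> (a - {x}), letter_type \<phi> (insert x a)}"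

primrec type_mult :: "mso \<Rightarrow> nat \<Rightarrow> nat \<Rightarrow> nat" where
  "type_mult (NotSub x y) s t = max s t"
| "type_mult (Before x y) s t = \<langle>max (pfst s) (pfst t), \<langle>max (pfst (psnd s)) (pfst (psnd t)),
     max (max (psnd (psnd s)) (psnd (psnd t))) (min (pfst s) (pfst (psnd t)))\<rangle>\<rangle>"
| "type_mult (MNot \<phi>) s t = type_mult \<phi> s t"
| "type_mult (MAnd \<phi> \<psi>) s t = \<langle>type_mult \<phi> (pfst s) (pfst t), type_mult \<psi> (psnd s) (psnd t)\<rangle>"
| "type_mult (MEx x \<phi>) s t = set_encode {type_mult \<phi> a b |a b. a \<in> set_decode s \<and> b \<in> set_decode t}"

text \<open>A pair \<open>(s, e)\<close> with \<open>s \<cdot> e = s\<close> and \<open>e \<cdot> e = e\<close> stands for the words \<open>w\<^sub>0 w\<^sub>1 w\<^sub>2 \<dots>\<close> in which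
  \<open>w\<^sub>0\<close> has type \<open>s\<close> and the other factors have type \<open>e\<close>.\<close>

primrec accepts :: "mso \<Rightarrow> nat \<Rightarrow> nat \<Rightarrow> bool" where
  "accepts (NotSub x y) s e \<longleftrightarrow> s = 1"
| "accepts (Before x y) s e \<longleftrightarrow> psnd (psnd s) = 1"
| "accepts (MNot \<phi>) s e \<longleftrightarrow> \<not> accepts \<phi> s e"
| "accepts (MAnd \<phi> \<psi>) s e \<longleftrightarrow> accepts \<phi> (pfst s) (pfst e) \<and> accepts \<psi> (psnd s) (psnd e)"
| "accepts (MEx x \<phi>) s e \<longleftrightarrow> (\<exists>a\<in>set_decode s. \<exists>b\<in>set_decode e.
     type_mult \<phi> a b = a \<and> type_mult \<phi> b b = b \<and> accepts \<phi> a b)"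

text \<open>The values are flags, pairs of types, or codes of subsets of a finite set of types. The
  bound depends neither on the length of words nor on the alphabet; it makes the set codes
  invertible and leaves finitely many colours for Ramsey's theorem.\<close>

lemma finite_range_word_type: "finite (range (word_type \<phi>))"
proof (induction \<phi>)
  case (NotSub x y)
  have "range (word_type (NotSub x y)) \<subseteq> {0, 1}"
    by (rule image_subsetI) simp
  then show ?case by (rule finite_subset) simp
next
  case (Before x y)
  let ?f = "\<lambda>(P, Q, R). \<langle>of_bool P, \<langle>of_bool Q, of_bool R\<rangle>\<rangle>"
  have "word_type (Before x y) w \<in> range ?f" for w
    by (rule range_eqI[of _ _ "(_, _, _)"]) simp
  then have "range (word_type (Before x y)) \<subseteq> range ?f" by blast
  then show ?case by (rule finite_subset) simp
next
  case (MNot \<phi>)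
  have "word_type (MNot \<phi>) = word_type \<phi>"
    by (rule ext) simp
  then show ?case using MNot by simp
next
  case (MAnd \<phi> \<psi>)
  have "range (word_type (MAnd \<phi> \<psi>)) \<subseteq> prod_encode ` (range (word_type \<phi>) \<times> range (word_type \<psi>))"
    by (rule image_subsetI) simp
  then show ?case by (rule finite_subset) (simp add: MAnd)
next
  case (MEx x \<phi>)
  have "range (word_type (MEx x \<phi>)) \<subseteq> set_encode ` Pow (range (word_type \<phi>))"
    by (rule image_subsetI, unfold word_type.simps, rule imageI) blast
  then show ?case by (rule finite_subset) (simp add: MEx)
qed

lemma set_decode_word_type_MEx: "set_decode (word_type (MEx x \<phi>) w) = word_type \<phi> ` variants x w"
proof -
  have "finite (word_type \<phi> ` variants x w)"
    by (rule finite_subset[OF _ finite_range_word_type[of \<phi>]]) auto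
  then show ?thesis by simp
qed

lemma variants_append: "variants x (u @ v) = {u' @ v' |u' v'. u' \<in> variants x u \<and> v' \<in> variants x v}"
  unfolding variants_def list_all2_append2 mem_Collect_eq using list_all2_lengthD by blast

lemma variants_single: "variants x [a] = {[a - {x}], [insert x a]}"
proof -
  have "b - {x} = a - {x} \<longleftrightarrow> b = a - {x} \<or> b = insert x a" for b
    by blast
  then show ?thesis
    by (auto simp: variants_def list_all2_Cons2)
qed

lemma word_type_single: "word_type \<phi> [a] = letter_type \<phi> a"
  by (induction \<phi> arbitrary: a) (simp_all add: variants_single)

lemma of_bool_max: "max (of_bool P) (of_bool Q) = (of_bool (P \<or> Q) :: nat)"
  by auto

lemma of_bool_min: "min (of_bool P) (of_bool Q) = (of_bool (P \<and> Q) :: nat)"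
  by auto

lemma two_positions_append:
  "(\<exists>j<length (u @ v). \<exists>i<j. P ((u @ v) ! i) \<and> Q ((u @ v) ! j)) \<longleftrightarrow>
   (\<exists>j<length u. \<exists>i<j. P (u ! i) \<and> Q (u ! j)) \<or> (\<exists>j<length v. \<exists>i<j. P (v ! i) \<and> Q (v ! j)) \<or>
   (\<exists>a\<in>set u. P a) \<and> (\<exists>b\<in>set v. Q b)"
  (is "?L \<longleftrightarrow> ?R1 \<or> ?R2 \<or> ?R3")
proof
  assume ?L
  then obtain i j where ij: "j < length u + length v" "i < j" "P ((u @ v) ! i)" "Q ((u @ v) ! j)"
    by auto
  consider "j < length u" | "i < length u" "length u \<le> j" | "length u \<le> i"
    using ij(2) by linarith
  then show "?R1 \<or> ?R2 \<or> ?R3"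
  proof cases
    case 1
    then show ?thesis using ij by (auto simp: nth_append)
  next
    case 2
    then have "P (u ! i)" "Q (v ! (j - length u))" "j - length u < length v"
      using ij by (auto simp: nth_append)
    then show ?thesis using 2 by (meson nth_mem)
  next
    case 3
    then have "P (v ! (i - length u))" "Q (v ! (j - length u))" "j - length u < length v"
      "i - length u < j - length u"
      using ij by (auto simp: nth_append)
    then show ?thesis by blast
  qed
next
  assume "?R1 \<or> ?R2 \<or> ?R3"
  then consider ?R1 | ?R2 | ?R3 by blast
  then show ?L
  proof cases
    case 1
    then obtain i j where "j < length u" "i < j" "P (u ! i)" "Q (u ! j)" by blast
    then show ?thesis
      by (intro exI[of _ j] conjI exI[of _ i]) (auto simp: nth_append)
  next
    case 2
    then obtain i j where "j < length v" "i < j" "P (v ! i)" "Q (v ! j)" by blast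
    then show ?thesis
      by (intro exI[of _ "length u + j"] conjI exI[of _ "length u + i"]) (auto simp: nth_append)
  next
    case 3
    then obtain i j where "i < length u" "P (u ! i)" "j < length v" "Q (v ! j)"
      by (auto simp: in_set_conv_nth)
    then show ?thesis
      by (intro exI[of _ "length u + j"] conjI exI[of _ i]) (auto simp: nth_append)
  qed
qed

text \<open>Types are multiplicative because the variants of a concatenation are exactly the
  concatenations of variants. The third flag of \<open>Before\<close> also records \<open>x\<close>
  to the left of the cut together with \<open>y\<close> to its right.\<close>

lemma word_type_append: "word_type \<phi> (u @ v) = type_mult \<phi> (word_type \<phi> u) (word_type \<phi> v)"
proof (induction \<phi> arbitrary: u v)
  case (NotSub x y)
  show ?case
    by (simp add: of_bool_max bex_Un del: of_bool_or_iff)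
next
  case (Before x y)
  show ?case
    unfolding word_type.simps type_mult.simps two_positions_append
    by (simp add: of_bool_max of_bool_min bex_Un disj_assoc del: of_bool_or_iff of_bool_conj)
next
  case (MEx x \<phi>)
  have "word_type \<phi> ` variants x (u @ v)
      = {type_mult \<phi> a b |a b. a \<in> word_type \<phi> ` variants x u \<and> b \<in> word_type \<phi> ` variants x v}"
    (is "?L = ?R")
  proof
    show "?L \<subseteq> ?R"
      unfolding variants_append using MEx by blast
    show "?R \<subseteq> ?L"
    proof
      fix c assume "c \<in> ?R"
      then obtain u' v' where "c = type_mult \<phi> (word_type \<phi> u') (word_type \<phi> v')"
        "u' \<in> variants x u" "v' \<in> variants x v"
        by blast
      then show "c \<in> ?L"
        unfolding variants_append using MEx[symmetric] by blast
    qed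
  qed
  then show ?case
    unfolding type_mult.simps set_decode_word_type_MEx by simp
qed simp_all

section \<open>Acceptance of infinite words\<close>

definition slice :: "nat trace \<Rightarrow> nat \<Rightarrow> nat \<Rightarrow> nat set list" where
  "slice \<alpha> i j = map \<alpha> [i..<j]"

lemma length_slice [simp]: "length (slice \<alpha> i j) = j - i"
  by (simp add: slice_def)

lemma nth_slice [simp]: "k < j - i \<Longrightarrow> slice \<alpha> i j ! k = \<alpha> (i + k)"
  by (simp add: slice_def)

lemma set_slice [simp]: "set (slice \<alpha> i j) = \<alpha> ` {i..<j}"
  by (simp add: slice_def)

lemma slice_append:
  assumes "i \<le> j" "j \<le> k"
  shows "slice \<alpha> i k = slice \<alpha> i j @ slice \<alpha> j k"
  using assms upt_add_eq_append[of i j "k - j"] by (simp add: slice_def flip: map_append)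

lemma word_type_slice_mult:
  assumes "i \<le> j" "j \<le> k"
  shows "word_type \<phi> (slice \<alpha> i k) = type_mult \<phi> (word_type \<phi> (slice \<alpha> i j)) (word_type \<phi> (slice \<alpha> j k))"
  unfolding slice_append[OF assms] by (rule word_type_append)

text \<open>All cuts and all pairs of cuts are covered, not only consecutive ones: the quantifier
  case reads the types at whatever positions a later subsequence selects.\<close>

definition factorized :: "mso \<Rightarrow> nat trace \<Rightarrow> (nat \<Rightarrow> nat) \<Rightarrow> nat \<Rightarrow> nat \<Rightarrow> bool" where
  "factorized \<phi> \<alpha> f s e \<longleftrightarrow> strict_mono f \<and> (\<forall>i. word_type \<phi> (slice \<alpha> 0 (f i)) = s) \<and>
     (\<forall>i j. i < j \<longrightarrow> word_type \<phi> (slice \<alpha> (f i) (f j)) = e)"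

lemma factorized_linked:
  assumes "factorized \<phi> \<alpha> f s e"
  shows "type_mult \<phi> s e = s" "type_mult \<phi> e e = e"
proof -
  have f: "strict_mono f" and s: "word_type \<phi> (slice \<alpha> 0 (f i)) = s"
    and e: "i < j \<Longrightarrow> word_type \<phi> (slice \<alpha> (f i) (f j)) = e" for i j
    using assms by (auto simp: factorized_def)
  have le: "f 0 \<le> f 1" "f 1 \<le> f 2"
    using f by (simp_all add: strict_mono_less_eq)
  show "type_mult \<phi> s e = s"
    using word_type_slice_mult[of 0 "f 0" "f 1" \<phi> \<alpha>] le s e[of 0 1] by simp
  show "type_mult \<phi> e e = e"
    using word_type_slice_mult[OF le, of \<phi> \<alpha>] e[of 0 1] e[of 1 2] e[of 0 2] by simp
qed

text \<open>The two linking equations absorb each additional block, so consecutive blocks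
  suffice.\<close>

lemma factorizedI:
  assumes f: "strict_mono f" and s: "word_type \<phi> (slice \<alpha> 0 (f 0)) = s"
    and e: "\<And>i. word_type \<phi> (slice \<alpha> (f i) (f (Suc i))) = e"
    and linked: "type_mult \<phi> s e = s" "type_mult \<phi> e e = e"
  shows "factorized \<phi> \<alpha> f s e"
proof -
  have mono: "f i \<le> f j" if "i \<le> j" for i j
    using f that by (simp add: strict_mono_less_eq)
  have "word_type \<phi> (slice \<alpha> 0 (f i)) = s" for i
  proof (induction i)
    case (Suc i)
    then show ?case
      using word_type_slice_mult[of 0 "f i" "f (Suc i)" \<phi> \<alpha>] mono[of i "Suc i"] e linked by simp
  qed (rule s)
  moreover have "word_type \<phi> (slice \<alpha> (f i) (f (Suc (i + k)))) = e" for i k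
  proof (induction k)
    case (Suc k)
    then show ?case
      using word_type_slice_mult[of "f i" "f (Suc (i + k))" "f (Suc (i + Suc k))" \<phi> \<alpha>]
        mono[of i "Suc (i + k)"] mono[of "Suc (i + k)" "Suc (i + Suc k)"] e[of "Suc (i + k)"] linked
      by simp
  qed (simp add: e)
  then have "word_type \<phi> (slice \<alpha> (f i) (f j)) = e" if "i < j" for i j
    using that less_imp_Suc_add by metis
  ultimately show ?thesis
    using f by (auto simp: factorized_def)
qed

text \<open>Pairs of cuts are coloured by the type of the slice between them. Starting from a given
  sequence \<open>f\<close> lets one word be factorized along the cuts of a factorization of
  another, as the quantifier case requires.\<close>

lemma factorized_subsequence:
  fixes f :: "nat \<Rightarrow> nat"
  assumes f: "strict_mono f"
  obtains g s e where "strict_mono g" "factorized \<phi> \<alpha> (f \<circ> g) s e"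
proof -
  obtain n where n: "word_type \<phi> w < n" for w
    using finite_range_word_type[of \<phi>] unfolding finite_nat_set_iff_bounded by blast
  \<comment> \<open>Ramsey's theorem colours two-element sets; minimum and maximum restore the order
    of the cuts.\<close>
  define c where "c X = word_type \<phi> (slice \<alpha> (f (Min X)) (f (Max X)))" for X
  have "\<forall>x\<in>UNIV. \<forall>y\<in>UNIV. x \<noteq> y \<longrightarrow> c {x, y} < n"
    by (simp add: c_def n)
  from Ramsey2[OF infinite_UNIV_nat this] obtain Y e where Y: "infinite Y"
    and e: "\<forall>x\<in>Y. \<forall>y\<in>Y. x \<noteq> y \<longrightarrow> c {x, y} = e"
    by (elim exE conjE)
  obtain h :: "nat \<Rightarrow> nat" where h: "strict_mono h" "\<And>i. h i \<in> Y"
    using infinite_enumerate[OF Y] by blast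
  \<comment> \<open>Dropping the first homogeneous cut makes the prefix end with a block of type
    \<open>e\<close>, so that a further factor of the idempotent type \<open>e\<close> changes
    nothing.\<close>
  define g where "g i = h (Suc i)" for i
  have g: "strict_mono g"
    using h(1) by (simp add: g_def strict_mono_def)
  have fg: "strict_mono (f \<circ> g)"
    using f g by (simp add: strict_mono_def)
  have e': "word_type \<phi> (slice \<alpha> (f (h i)) (f (h j))) = e" if "i < j" for i j
  proof -
    have "h i < h j"
      using that h(1) by (simp add: strict_mono_def)
    then show ?thesis
      using e[rule_format, of "h i" "h j"] h(2) by (simp add: c_def)
  qed
  have le: "f (h i) \<le> f (h j)" if "i \<le> j" for i j
    using f h(1) that by (simp add: strict_mono_less_eq)
  have ee: "type_mult \<phi> e e = e"
    using word_type_slice_mult[OF le[of 0 1] le[of 1 2], of \<phi> \<alpha>] e'[of 0 1] e'[of 1 2] e'[of 0 2] by simp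
  have "type_mult \<phi> (word_type \<phi> (slice \<alpha> 0 (f (g 0)))) e = word_type \<phi> (slice \<alpha> 0 (f (g 0)))"
  proof -
    have "type_mult \<phi> (word_type \<phi> (slice \<alpha> 0 (f (g 0)))) e = word_type \<phi> (slice \<alpha> 0 (f (g 1)))"
      using word_type_slice_mult[of 0 "f (g 0)" "f (g 1)" \<phi> \<alpha>] le[of 1 2] e'[of 1 2]
      by (simp add: g_def numeral_2_eq_2)
    also have "\<dots> = type_mult \<phi> (word_type \<phi> (slice \<alpha> 0 (f (h 0)))) e"
      using word_type_slice_mult[of 0 "f (h 0)" "f (g 1)" \<phi> \<alpha>] le[of 0 2] e'[of 0 2]
      by (simp add: g_def numeral_2_eq_2)
    also have "\<dots> = word_type \<phi> (slice \<alpha> 0 (f (g 0)))"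
      using word_type_slice_mult[of 0 "f (h 0)" "f (g 0)" \<phi> \<alpha>] le[of 0 1] e'[of 0 1]
      by (simp add: g_def)
    finally show ?thesis .
  qed
  then have "factorized \<phi> \<alpha> (f \<circ> g) (word_type \<phi> (slice \<alpha> 0 (f (g 0)))) e"
    using fg e'[OF lessI] ee by (intro factorizedI) (simp_all add: g_def)
  with g show ?thesis using that by blast
qed

lemma holds_tracks_MEx:
  "holds (tracks \<alpha>) (MEx x \<phi>) \<longleftrightarrow> (\<exists>\<beta>. (\<forall>n. \<beta> n - {x} = \<alpha> n - {x}) \<and> holds (tracks \<beta>) \<phi>)"
proof
  assume "holds (tracks \<alpha>) (MEx x \<phi>)"
  then obtain X where X: "holds ((tracks \<alpha>)(x := X)) \<phi>" by auto
  define \<beta> where "\<beta> n = (if n \<in> X then insert x (\<alpha> n) else \<alpha> n - {x})" for n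
  have "tracks \<beta> = (tracks \<alpha>)(x := X)"
    by (auto simp: tracks_def \<beta>_def fun_eq_iff)
  then show "\<exists>\<beta>. (\<forall>n. \<beta> n - {x} = \<alpha> n - {x}) \<and> holds (tracks \<beta>) \<phi>"
    using X by (intro exI[of _ \<beta>]) (auto simp: \<beta>_def)
next
  assume "\<exists>\<beta>. (\<forall>n. \<beta> n - {x} = \<alpha> n - {x}) \<and> holds (tracks \<beta>) \<phi>"
  then obtain \<beta> where \<beta>: "\<And>n. \<beta> n - {x} = \<alpha> n - {x}" "holds (tracks \<beta>) \<phi>" by blast
  have "y \<in> \<beta> n \<longleftrightarrow> y \<in> \<alpha> n" if "y \<noteq> x" for y n
    using \<beta>(1)[of n] that by blast
  then have "tracks \<beta> = (tracks \<alpha>)(x := tracks \<beta> x)"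
    by (auto simp: tracks_def fun_eq_iff)
  then show "holds (tracks \<alpha>) (MEx x \<phi>)"
    using \<beta>(2) by (metis holds.simps(5))
qed

lemma slice_in_variants:
  assumes "\<And>n. \<beta> n - {x} = \<alpha> n - {x}"
  shows "slice \<beta> i j \<in> variants x (slice \<alpha> i j)"
  using assms by (simp add: variants_def list_all2_conv_all_nth)

text \<open>The chosen blocks are glued into one word. The cuts increase only weakly, because the
  first block is empty if a factorization has its first cut at 0.\<close>

lemma concat_variants:
  assumes c: "mono c" "c 0 = 0" "\<And>n. \<exists>i. n < c (Suc i)"
    and w: "\<And>i. w i \<in> variants x (slice \<alpha> (c i) (c (Suc i)))"
  obtains \<beta> where "\<And>n. \<beta> n - {x} = \<alpha> n - {x}" "\<And>i. slice \<beta> (c i) (c (Suc i)) = w i"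
proof -
  define block where "block n = (LEAST i. n < c (Suc i))" for n
  define \<beta> where "\<beta> n = w (block n) ! (n - c (block n))" for n
  have len: "length (w i) = c (Suc i) - c i" for i
    using w[of i] by (auto simp: variants_def dest: list_all2_lengthD)
  have block_eq: "block n = i" if "c i \<le> n" "n < c (Suc i)" for n i
    unfolding block_def
  proof (rule Least_equality)
    fix j assume "n < c (Suc j)"
    then have "c i < c (Suc j)" using that by simp
    then have "\<not> Suc j \<le> i" using monoD[OF c(1), of "Suc j" i] by linarith
    then show "i \<le> j" by simp
  qed (rule that)
  have block: "c (block n) \<le> n" "n < c (Suc (block n))" for n
  proof -
    show "n < c (Suc (block n))"
      unfolding block_def using c(3)[of n] by (rule LeastI_ex)
    show "c (block n) \<le> n"
    proof (cases "block n")
      case (Suc i)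
      then have "\<not> n < c (Suc i)"
        unfolding block_def by (metis lessI not_less_Least)
      then show ?thesis using Suc by simp
    qed (simp add: c)
  qed
  have "\<beta> n - {x} = \<alpha> n - {x}" for n
    using w[of "block n"] block[of n] by (simp add: variants_def list_all2_conv_all_nth \<beta>_def len diff_less_mono)
  moreover have "slice \<beta> (c i) (c (Suc i)) = w i" for i
  proof (rule nth_equalityI)
    fix k assume "k < length (slice \<beta> (c i) (c (Suc i)))"
    then show "slice \<beta> (c i) (c (Suc i)) ! k = w i ! k"
      using block_eq[of i "c i + k"] by (simp add: \<beta>_def)
  qed (simp add: len)
  ultimately show ?thesis using that by blast
qed

lemma strict_mono_eventually_greater:
  fixes f :: "nat \<Rightarrow> nat"
  assumes "strict_mono f"
  shows "n < f (Suc n)"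
  using strict_mono_imp_increasing[OF assms, of "Suc n"] by simp

text \<open>For an atom, the prefixes up to all cuts have the same flag, so this flag decides the
  infinite word. For a quantifier, a witness is factorized along a subsequence of the given cuts,
  and its types lie in the sets coded by \<open>s\<close> and \<open>e\<close>. Conversely, the
  blocks have variants of the chosen types, which can be glued, and the linking equations make the
  result a factorization.\<close>

theorem holds_iff_accepts:
  assumes "factorized \<phi> \<alpha> f s e"
  shows "holds (tracks \<alpha>) \<phi> \<longleftrightarrow> accepts \<phi> s e"
  using assms
proof (induction \<phi> arbitrary: \<alpha> f s e)
  case (NotSub x y)
  have f: "strict_mono f" and "word_type (NotSub x y) (slice \<alpha> 0 (f i)) = s" for i
    using NotSub by (simp_all add: factorized_def)
  then have s: "s = of_bool (\<exists>n<f i. x \<in> \<alpha> n \<and> y \<notin> \<alpha> n)" for i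
    by (simp add: atLeast0LessThan Bex_def)
  have "(\<exists>n. x \<in> \<alpha> n \<and> y \<notin> \<alpha> n) \<longleftrightarrow> (\<exists>i. \<exists>n<f i. x \<in> \<alpha> n \<and> y \<notin> \<alpha> n)"
    using strict_mono_eventually_greater[OF f] by blast
  moreover have hit: "(\<exists>n<f i. x \<in> \<alpha> n \<and> y \<notin> \<alpha> n) \<longleftrightarrow> s = 1" for i
    by (subst s[of i]) simp
  ultimately show ?case
    unfolding hit by (auto simp: tracks_def)
next
  case (Before x y)
  have f: "strict_mono f" and w: "word_type (Before x y) (slice \<alpha> 0 (f i)) = s" for i
    using Before by (simp_all add: factorized_def)
  have "(\<exists>n<k. \<exists>m<n. x \<in> slice \<alpha> 0 k ! m \<and> y \<in> slice \<alpha> 0 k ! n) \<longleftrightarrow>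
      (\<exists>n<k. \<exists>m<n. x \<in> \<alpha> m \<and> y \<in> \<alpha> n)" for k
    by (intro ex_cong1 conj_cong) simp_all
  then have s: "psnd (psnd s) = of_bool (\<exists>n<f i. \<exists>m<n. x \<in> \<alpha> m \<and> y \<in> \<alpha> n)" for i
    unfolding w[of i, symmetric] by simp
  have "(\<exists>n. \<exists>m<n. x \<in> \<alpha> m \<and> y \<in> \<alpha> n) \<longleftrightarrow> (\<exists>i. \<exists>n<f i. \<exists>m<n. x \<in> \<alpha> m \<and> y \<in> \<alpha> n)"
    using strict_mono_eventually_greater[OF f] by blast
  moreover have hit: "(\<exists>n<f i. \<exists>m<n. x \<in> \<alpha> m \<and> y \<in> \<alpha> n) \<longleftrightarrow> psnd (psnd s) = 1" for i
    by (subst s[of i]) simp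
  ultimately show ?case
    unfolding hit by (auto simp: tracks_def)
next
  case (MNot \<phi>)
  then show ?case by (simp add: factorized_def)
next
  case (MAnd \<phi> \<psi>)
  from MAnd.prems have f: "strict_mono f"
    and s: "word_type (MAnd \<phi> \<psi>) (slice \<alpha> 0 (f i)) = s"
    and e: "i < j \<Longrightarrow> word_type (MAnd \<phi> \<psi>) (slice \<alpha> (f i) (f j)) = e" for i j
    unfolding factorized_def by blast+
  have "factorized \<phi> \<alpha> f (pfst s) (pfst e)"
    unfolding factorized_def
  proof (intro conjI allI impI f)
    show "word_type \<phi> (slice \<alpha> 0 (f i)) = pfst s" for i
      by (subst s[of i, symmetric]) simp
    show "word_type \<phi> (slice \<alpha> (f i) (f j)) = pfst e" if "i < j" for i j
      by (subst e[OF that, symmetric]) simp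
  qed
  moreover have "factorized \<psi> \<alpha> f (psnd s) (psnd e)"
    unfolding factorized_def
  proof (intro conjI allI impI f)
    show "word_type \<psi> (slice \<alpha> 0 (f i)) = psnd s" for i
      by (subst s[of i, symmetric]) simp
    show "word_type \<psi> (slice \<alpha> (f i) (f j)) = psnd e" if "i < j" for i j
      by (subst e[OF that, symmetric]) simp
  qed
  ultimately show ?case
    using MAnd.IH by simp
next
  case (MEx x \<phi>)
  from MEx.prems have f: "strict_mono f"
    and s': "word_type (MEx x \<phi>) (slice \<alpha> 0 (f i)) = s"
    and e': "i < j \<Longrightarrow> word_type (MEx x \<phi>) (slice \<alpha> (f i) (f j)) = e" for i j
    unfolding factorized_def by blast+
  have s: "set_decode s = word_type \<phi> ` variants x (slice \<alpha> 0 (f i))" for i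
    by (subst s'[of i, symmetric]) (rule set_decode_word_type_MEx)
  have e: "set_decode e = word_type \<phi> ` variants x (slice \<alpha> (f i) (f j))" if "i < j" for i j
    by (subst e'[OF that, symmetric]) (rule set_decode_word_type_MEx)
  show ?case
  proof
    assume "holds (tracks \<alpha>) (MEx x \<phi>)"
    then obtain \<beta> where \<beta>: "\<And>n. \<beta> n - {x} = \<alpha> n - {x}" "holds (tracks \<beta>) \<phi>"
      unfolding holds_tracks_MEx by blast
    obtain g a b where g: "strict_mono g" and ab: "factorized \<phi> \<beta> (f \<circ> g) a b"
      using factorized_subsequence[OF f] by blast
    have a: "a = word_type \<phi> (slice \<beta> 0 (f (g 0)))" and b: "b = word_type \<phi> (slice \<beta> (f (g 0)) (f (g 1)))"
      using ab by (simp_all add: factorized_def)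
    have "g 0 < g 1"
      using g by (simp add: strict_mono_def)
    then have "a \<in> set_decode s" "b \<in> set_decode e"
      unfolding s[of "g 0"] e[OF \<open>g 0 < g 1\<close>] a b by (intro imageI slice_in_variants \<beta>(1))+
    then show "accepts (MEx x \<phi>) s e"
      using factorized_linked[OF ab] MEx.IH[OF ab] \<beta>(2) unfolding accepts.simps by blast
  next
    assume "accepts (MEx x \<phi>) s e"
    then obtain a b where ab: "a \<in> set_decode s" "b \<in> set_decode e"
      "type_mult \<phi> a b = a" "type_mult \<phi> b b = b" "accepts \<phi> a b"
      by auto
    \<comment> \<open>The prefix up to the first cut becomes block 0, and the blocks between cuts
      are shifted by one.\<close>
    define c where "c i = (case i of 0 \<Rightarrow> 0 | Suc j \<Rightarrow> f j)" for i
    have "c n \<le> c (Suc n)" for n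
      using f by (auto simp: c_def strict_mono_less_eq split: nat.split)
    then have c: "mono c" "c 0 = 0" "\<exists>i. n < c (Suc i)" for n
      using strict_mono_eventually_greater[OF f, of n] by (auto simp: mono_iff_le_Suc c_def)
    have "\<exists>v \<in> variants x (slice \<alpha> (c i) (c (Suc i))). word_type \<phi> v = (if i = 0 then a else b)" for i
      using s[of 0] e[of "i - 1" i] ab(1,2) by (cases i) (auto simp: c_def)
    then obtain w where w: "\<And>i. w i \<in> variants x (slice \<alpha> (c i) (c (Suc i)))"
      "\<And>i. word_type \<phi> (w i) = (if i = 0 then a else b)"
      by metis
    obtain \<beta> where \<beta>: "\<And>n. \<beta> n - {x} = \<alpha> n - {x}" "\<And>i. slice \<beta> (c i) (c (Suc i)) = w i"
      using concat_variants[OF c w(1)] by blast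
    have "factorized \<phi> \<beta> f a b"
      using f \<beta>(2)[of 0] \<beta>(2)[of "Suc i" for i] w(2) ab(3,4)
      by (intro factorizedI) (auto simp: c_def)
    then show "holds (tracks \<alpha>) (MEx x \<phi>)"
      unfolding holds_tracks_MEx using MEx.IH \<beta>(1) ab(5) by blast
  qed
qed

section \<open>Minimal counterfactuals\<close>

text \<open>Given a strictly weaker property that still works, one world is chosen whose addition
  already works: a witness of the weaker property that the old antecedent misses or, if the
  witnesses in question all satisfy the old antecedent, an arbitrary new world.\<close>

lemma cf_min_holds_iff:
  assumes refl: "reflp_on U le"
  shows "cf_min_holds U le c \<phi> \<psi> \<longleftrightarrow> cf_holds U le c \<phi> \<psi> \<and>
    \<not> (\<exists>x\<in>U. \<not> \<phi> x \<and> cf_holds U le c (\<lambda>W. \<phi> W \<or> W = x) \<psi>)"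
proof -
  have le: "le x x" if "x \<in> U" for x
    using refl that by (rule reflp_onD)
  have "\<exists>x\<in>U. \<not> \<phi> x \<and> cf_holds U le c (\<lambda>W. \<phi> W \<or> W = x) \<psi>"
    if \<phi>: "cf_holds U le c \<phi> \<psi>" and weaker: "\<And>W. W \<in> U \<Longrightarrow> \<phi> W \<Longrightarrow> \<phi>' W"
      and z: "z \<in> U" "\<phi>' z" "\<not> \<phi> z" and \<phi>': "cf_holds U le c \<phi>' \<psi>" for \<phi>' z
  proof (cases c)
    case Would
    obtain W where W: "W \<in> U" "\<phi>' W" "\<And>V. V \<in> U \<Longrightarrow> le V W \<Longrightarrow> \<phi>' V \<Longrightarrow> \<psi> V"
      using \<phi>' z by (auto simp: Would)
    show ?thesis
    proof (cases "\<phi> W")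
      case True
      then have "cf_holds U le c (\<lambda>V. \<phi> V \<or> V = z) \<psi>"
        using W z weaker by (auto simp: Would)
      with z show ?thesis by blast
    next
      case False
      have "cf_holds U le c (\<lambda>V. \<phi> V \<or> V = W) \<psi>"
        using W weaker by (auto simp: Would)
      with W False show ?thesis by blast
    qed
  next
    case Might
    obtain y where y: "y \<in> U" "le y z" "\<phi>' y" "\<psi> y"
      using \<phi>' z by (auto simp: Might)
    show ?thesis
    proof (cases "\<phi> y")
      case True
      have "cf_holds U le c (\<lambda>V. \<phi> V \<or> V = z) \<psi>"
        using \<phi> y True z unfolding Might cf_holds.simps by blast
      with z show ?thesis by blast
    next
      case False
      have "cf_holds U le c (\<lambda>V. \<phi> V \<or> V = y) \<psi>"
        using \<phi> y le[OF y(1)] unfolding Might cf_holds.simps by blast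
      with y False show ?thesis by blast
    qed
  next
    case Universal_Would
    \<comment> \<open>Worlds below which the weaker antecedent forces the consequent: the inner
      witnesses of the universal operator.\<close>
    define clean where "clean V \<longleftrightarrow> V \<in> U \<and> \<phi>' V \<and> (\<forall>V'\<in>U. le V' V \<longrightarrow> \<phi>' V' \<longrightarrow> \<psi> V')" for V
    have clean: "\<exists>V. clean V \<and> le V W" if "W \<in> U" "\<phi>' W" for W
      using \<phi>' that unfolding Universal_Would cf_holds.simps clean_def by blast
    show ?thesis
    \<comment> \<open>A clean world satisfies \<open>\<psi>\<close> by reflexivity, so adding it
      spoils no other witness. If every clean world satisfies \<open>\<phi>\<close>, the clean
      worlds remain witnesses after any new world of the weaker property is added.\<close>
    proof (cases "\<exists>y. clean y \<and> \<not> \<phi> y")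
      case True
      then obtain y where y: "clean y" "\<not> \<phi> y" by blast
      then have yU: "y \<in> U" "\<psi> y" using le by (auto simp: clean_def)
      have "\<exists>V\<in>U. le V W \<and> (\<phi> V \<or> V = y) \<and> (\<forall>V'\<in>U. le V' V \<longrightarrow> \<phi> V' \<or> V' = y \<longrightarrow> \<psi> V')"
        if W: "W \<in> U" "\<phi> W \<or> W = y" for W
      proof (cases "W = y")
        case True
        then show ?thesis using y weaker le unfolding clean_def by blast
      next
        case False
        then obtain V where "V \<in> U" "le V W" "\<phi> V" "\<forall>V'\<in>U. le V' V \<longrightarrow> \<phi> V' \<longrightarrow> \<psi> V'"
          using \<phi> W unfolding Universal_Would cf_holds.simps by blast
        then show ?thesis using yU by blast
      qed
      then have "cf_holds U le c (\<lambda>V. \<phi> V \<or> V = y) \<psi>"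
        unfolding Universal_Would cf_holds.simps by blast
      with yU y show ?thesis by blast
    next
      case False
      have "\<exists>V\<in>U. le V W \<and> (\<phi> V \<or> V = z) \<and> (\<forall>V'\<in>U. le V' V \<longrightarrow> \<phi> V' \<or> V' = z \<longrightarrow> \<psi> V')"
        if W: "W \<in> U" "\<phi> W \<or> W = z" for W
      proof -
        have "\<phi>' W" using W weaker z by blast
        with clean W obtain V where V: "clean V" "le V W" by blast
        then have "\<phi> V" using False by blast
        then show ?thesis using V weaker z unfolding clean_def by blast
      qed
      then have "cf_holds U le c (\<lambda>V. \<phi> V \<or> V = z) \<psi>"
        unfolding Universal_Would cf_holds.simps by blast
      with z show ?thesis by blast
    qed
  next
    case Existential_Might
    obtain W where W: "W \<in> U" "\<phi> W"
      "\<And>V. V \<in> U \<Longrightarrow> le V W \<Longrightarrow> \<phi> V \<Longrightarrow> \<exists>V'\<in>U. le V' V \<and> \<phi> V' \<and> \<psi> V'"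
      using \<phi> by (auto simp: Existential_Might)
    obtain W' where W': "W' \<in> U" "\<phi>' W'"
      "\<And>V. V \<in> U \<Longrightarrow> le V W' \<Longrightarrow> \<phi>' V \<Longrightarrow> \<exists>V'\<in>U. le V' V \<and> \<phi>' V' \<and> \<psi> V'"
      using \<phi>' by (auto simp: Existential_Might)
    show ?thesis
    \<comment> \<open>An added world satisfying \<open>\<psi>\<close> is its own witness and leaves
      the choice of \<open>W\<close> valid.\<close>
    proof (cases "\<exists>y\<in>U. \<phi>' y \<and> \<psi> y \<and> \<not> \<phi> y")
      case True
      then obtain y where y: "y \<in> U" "\<psi> y" "\<not> \<phi> y" by blast
      have "cf_holds U le c (\<lambda>V. \<phi> V \<or> V = y) \<psi>"
        unfolding Existential_Might cf_holds.simps
        using W y le[OF y(1)] by (intro bexI[of _ W]) blast+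
      with y show ?thesis by blast
    next
      case False
      \<comment> \<open>No world satisfying both \<open>\<phi>'\<close> and \<open>\<psi>\<close> is
        new, so the witnesses below \<open>W'\<close> survive; \<open>x\<close> is chosen so that
        \<open>W'\<close> satisfies the weakened antecedent.\<close>
      define x where "x = (if \<phi> W' then z else W')"
      have x: "x \<in> U" "\<not> \<phi> x" "\<phi>' x" "\<phi> W' \<or> W' = x"
        using W' z by (auto simp: x_def)
      have "\<exists>V'\<in>U. le V' V \<and> (\<phi> V' \<or> V' = x) \<and> \<psi> V'"
        if "V \<in> U" "le V W'" "\<phi> V \<or> V = x" for V
        using W'(3)[of V] that weaker x False by blast
      then have "cf_holds U le c (\<lambda>V. \<phi> V \<or> V = x) \<psi>"
        unfolding Existential_Might cf_holds.simps
        using W'(1) x(4) by (intro bexI[of _ W']) blast+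
      with x show ?thesis by blast
    qed
  qed
  then have "(\<exists>\<phi>'. (\<forall>W\<in>U. \<phi> W \<longrightarrow> \<phi>' W) \<and> \<not> (\<forall>W\<in>U. \<phi>' W \<longrightarrow> \<phi> W) \<and> cf_holds U le c \<phi>' \<psi>)
      \<Longrightarrow> cf_holds U le c \<phi> \<psi>
      \<Longrightarrow> \<exists>x\<in>U. \<not> \<phi> x \<and> cf_holds U le c (\<lambda>W. \<phi> W \<or> W = x) \<psi>"
    by blast
  moreover have "\<exists>\<phi>'. (\<forall>W\<in>U. \<phi> W \<longrightarrow> \<phi>' W) \<and> \<not> (\<forall>W\<in>U. \<phi>' W \<longrightarrow> \<phi> W) \<and> cf_holds U le c \<phi>' \<psi>"
    if "x \<in> U" "\<not> \<phi> x" "cf_holds U le c (\<lambda>W. \<phi> W \<or> W = x) \<psi>" for x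
    using that by (intro exI[of _ "\<lambda>W. \<phi> W \<or> W = x"]) blast
  ultimately show ?thesis
    unfolding cf_min_holds_def by blast
qed

section \<open>Translation of QPTL\<close>

text \<open>Tags 0 to 4 belong to the propositions of the five worlds and 6 to auxiliary
  propositions of the similarity formula, which leaves 5 for positions.\<close>

abbreviation pos_var :: "nat \<Rightarrow> nat" where
  "pos_var d \<equiv> \<langle>5, d\<rangle>"

text \<open>A set is nonempty iff some set fails to include it. The bound variable only has to
  differ from \<open>x\<close>, so \<open>Suc x\<close> works in any context.\<close>

definition sing :: "nat \<Rightarrow> mso" where
  "sing x = MAnd (MNot (Before x x)) (MEx (Suc x) (NotSub x (Suc x)))"

lemma holds_sing: "holds e (sing x) \<longleftrightarrow> (\<exists>i. e x = {i})"
proof -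
  have "holds e (sing x) \<longleftrightarrow> (\<forall>i\<in>e x. \<forall>j\<in>e x. \<not> i < j) \<and> e x \<noteq> {}"
    by (auto simp: sing_def)
  also have "\<dots> \<longleftrightarrow> (\<exists>i. e x = {i})"
  proof
    assume *: "(\<forall>i\<in>e x. \<forall>j\<in>e x. \<not> i < j) \<and> e x \<noteq> {}"
    then obtain i where "i \<in> e x" by blast
    moreover have "j = i" if "j \<in> e x" for j
      using * that \<open>i \<in> e x\<close> by (meson linorder_neqE_nat)
    ultimately show "\<exists>i. e x = {i}" by blast
  qed auto
  finally show ?thesis .
qed

lemma holds_MEx_sing:
  "holds e (MEx x (MAnd (sing x) \<phi>)) \<longleftrightarrow> (\<exists>i. holds (e(x := {i})) \<phi>)"
  by (auto simp: holds_sing)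

text \<open>In \<open>ltl_mso \<rho> \<phi> d\<close> the variable \<open>\<rho> a\<close> stands for the proposition \<open>a\<close>, and the current position
  is the element of the singleton \<open>pos_var d\<close>.\<close>

primrec ltl_mso :: "('a \<Rightarrow> nat) \<Rightarrow> 'a ltl \<Rightarrow> nat \<Rightarrow> mso" where
  "ltl_mso \<rho> (Atom a) d = MNot (NotSub (pos_var d) (\<rho> a))"
| "ltl_mso \<rho> (Neg \<phi>) d = MNot (ltl_mso \<rho> \<phi> d)"
| "ltl_mso \<rho> (Conj \<phi> \<psi>) d = MAnd (ltl_mso \<rho> \<phi> d) (ltl_mso \<rho> \<psi> d)"
| "ltl_mso \<rho> (Next \<phi>) d = MEx (pos_var (d + 1)) (MAnd (sing (pos_var (d + 1)))
     (MAnd (Before (pos_var d) (pos_var (d + 1)))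
     (MAnd (MNot (MEx (pos_var (d + 2)) (MAnd (sing (pos_var (d + 2)))
        (MAnd (Before (pos_var d) (pos_var (d + 2))) (Before (pos_var (d + 2)) (pos_var (d + 1)))))))
     (ltl_mso \<rho> \<phi> (d + 1)))))"
| "ltl_mso \<rho> (Until \<phi> \<psi>) d = MEx (pos_var (d + 1)) (MAnd (sing (pos_var (d + 1)))
     (MAnd (MNot (Before (pos_var (d + 1)) (pos_var d)))
     (MAnd (ltl_mso \<rho> \<psi> (d + 1))
     (MNot (MEx (pos_var (d + 2)) (MAnd (sing (pos_var (d + 2)))
        (MAnd (MNot (Before (pos_var (d + 2)) (pos_var d)))
        (MAnd (Before (pos_var (d + 2)) (pos_var (d + 1))) (MNot (ltl_mso \<rho> \<phi> (d + 2)))))))))))"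

definition trace_of :: "('a \<Rightarrow> nat) \<Rightarrow> (nat \<Rightarrow> nat set) \<Rightarrow> 'a trace" where
  "trace_of \<rho> e n = {a. n \<in> e (\<rho> a)}"

lemma trace_of_upd_other: "(\<And>a. \<rho> a \<noteq> x) \<Longrightarrow> trace_of \<rho> (e(x := X)) = trace_of \<rho> e"
  by (simp add: trace_of_def fun_eq_iff)

lemma holds_ltl_mso:
  assumes \<rho>: "\<And>a d. \<rho> a \<noteq> pos_var d" and "e (pos_var d) = {i}"
  shows "holds e (ltl_mso \<rho> \<phi> d) \<longleftrightarrow> ltl_sat (trace_of \<rho> e) i \<phi>"
  using assms(2)
proof (induction \<phi> arbitrary: e d i)
  case (Atom a)
  then show ?case by (simp add: trace_of_def)
next
  case (Next \<phi>)
  let ?e = "\<lambda>j. e(pos_var (d + 1) := {j})"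
  have IH: "holds (?e j) (ltl_mso \<rho> \<phi> (d + 1)) \<longleftrightarrow> ltl_sat (trace_of \<rho> e) j \<phi>" for j
    using Next.IH[of "?e j" "d + 1" j, OF fun_upd_same] unfolding trace_of_upd_other[of \<rho>, OF \<rho>] .
  have "holds e (ltl_mso \<rho> (Next \<phi>) d) \<longleftrightarrow>
      (\<exists>j. i < j \<and> \<not> (\<exists>k. i < k \<and> k < j) \<and> ltl_sat (trace_of \<rho> e) j \<phi>)"
    unfolding ltl_mso.simps holds_MEx_sing holds.simps(3,4) IH by (simp add: Next.prems)
  also have "\<dots> \<longleftrightarrow> ltl_sat (trace_of \<rho> e) (Suc i) \<phi>"
    by (metis Suc_lessI lessI not_less_eq)
  finally show ?case by simp
next
  case (Until \<phi> \<psi>)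
  let ?e = "\<lambda>k. e(pos_var (d + 1) := {k})"
  let ?e' = "\<lambda>k j. (?e k)(pos_var (d + 2) := {j})"
  have IH: "holds (?e k) (ltl_mso \<rho> \<psi> (d + 1)) \<longleftrightarrow> ltl_sat (trace_of \<rho> e) k \<psi>"
    "holds (?e' k j) (ltl_mso \<rho> \<phi> (d + 2)) \<longleftrightarrow> ltl_sat (trace_of \<rho> e) j \<phi>" for j k
    using Until.IH(2)[of "?e k" "d + 1" k, OF fun_upd_same]
      Until.IH(1)[of "?e' k j" "d + 2" j, OF fun_upd_same]
    unfolding trace_of_upd_other[of \<rho>, OF \<rho>] .
  have "holds e (ltl_mso \<rho> (Until \<phi> \<psi>) d) \<longleftrightarrow>
      (\<exists>k. \<not> k < i \<and> ltl_sat (trace_of \<rho> e) k \<psi> \<and>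
         \<not> (\<exists>j. \<not> j < i \<and> j < k \<and> \<not> ltl_sat (trace_of \<rho> e) j \<phi>))"
    unfolding ltl_mso.simps holds_MEx_sing holds.simps(3,4) IH by (simp add: Until.prems)
  also have "\<dots> \<longleftrightarrow> ltl_sat (trace_of \<rho> e) i (Until \<phi> \<psi>)"
    unfolding ltl_sat.simps not_less by blast
  finally show ?case .
qed simp_all

text \<open>In the \<open>LTL\<close> case the initial position is characterized as the one before
  which no set has an element.\<close>

primrec qptl_mso :: "('a \<Rightarrow> nat) \<Rightarrow> 'a qptl \<Rightarrow> mso" where
  "qptl_mso \<rho> (Exists q \<psi>) = MEx (\<rho> q) (qptl_mso \<rho> \<psi>)"
| "qptl_mso \<rho> (Forall q \<psi>) = MNot (MEx (\<rho> q) (MNot (qptl_mso \<rho> \<psi>)))"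
| "qptl_mso \<rho> (LTL \<phi>) = MEx (pos_var 0) (MAnd (sing (pos_var 0))
     (MAnd (MNot (MEx (pos_var 1) (Before (pos_var 1) (pos_var 0)))) (ltl_mso \<rho> \<phi> 0)))"

lemma trace_of_upd:
  assumes "inj \<rho>"
  shows "(\<exists>X. P (trace_of \<rho> (e(\<rho> q := X)))) \<longleftrightarrow> (\<exists>t\<in>traces {q}. P (trace_upd (trace_of \<rho> e) q t))"
proof -
  have 1: "trace_of \<rho> (e(\<rho> q := X)) = trace_upd (trace_of \<rho> e) q (\<lambda>n. {a. a = q \<and> n \<in> X})" for X
    using assms by (auto simp: trace_of_def trace_upd_def fun_eq_iff inj_eq)
  have 2: "trace_upd (trace_of \<rho> e) q t = trace_of \<rho> (e(\<rho> q := {n. q \<in> t n}))" for t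
    using assms by (auto simp: trace_of_def trace_upd_def fun_eq_iff inj_eq)
  have 3: "(\<lambda>n. {a. a = q \<and> n \<in> X}) \<in> traces {q}" for X
    by (auto simp: traces_def)
  show ?thesis
    using 1 2 3 by metis
qed

lemma holds_qptl_mso:
  assumes \<rho>: "\<And>a d. \<rho> a \<noteq> pos_var d" "inj \<rho>"
  shows "holds e (qptl_mso \<rho> \<psi>) \<longleftrightarrow> qptl_sat (trace_of \<rho> e) \<psi>"
proof (induction \<psi> arbitrary: e)
  case (Exists q \<psi>)
  then show ?case
    using trace_of_upd[OF \<rho>(2), of "\<lambda>t. qptl_sat t \<psi>" e q] by (simp del: fun_upd_apply)
next
  case (Forall q \<psi>)
  then show ?case
    using trace_of_upd[OF \<rho>(2), of "\<lambda>t. \<not> qptl_sat t \<psi>" e q] by (simp del: fun_upd_apply)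
next
  case (LTL \<phi>)
  have "holds (e(pos_var 0 := {i})) (ltl_mso \<rho> \<phi> 0) \<longleftrightarrow> ltl_sat (trace_of \<rho> e) i \<phi>" for i
    using holds_ltl_mso[of \<rho> "e(pos_var 0 := {i})" 0 i \<phi>, OF \<rho>(1)]
    unfolding trace_of_upd_other[of \<rho>, OF \<rho>(1)] by simp
  moreover have "holds (e(pos_var 0 := {i})) (MEx (pos_var 1) (Before (pos_var 1) (pos_var 0))) \<longleftrightarrow> 0 < i" for i
    by (auto intro!: exI[of _ "{0}"])
  ultimately show ?case
    unfolding qptl_mso.simps holds_MEx_sing holds.simps(3,4) by simp
qed

lemma ltl_sat_cong:
  assumes "\<And>n. t n \<inter> A = t' n \<inter> A" "set_ltl \<phi> \<subseteq> A"
  shows "ltl_sat t i \<phi> \<longleftrightarrow> ltl_sat t' i \<phi>"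
  using assms(2)
proof (induction \<phi> arbitrary: i)
  case (Atom a)
  then show ?case using assms(1)[of i] by auto
qed simp_all

text \<open>\<open>trace_of\<close> reads a valuation at every proposition, while worlds keep only
  those of \<open>AP\<close>; agreement on the free propositions bridges the two. The set
  \<open>A\<close> grows along the quantifier prefix.\<close>

lemma qptl_sat_cong:
  assumes "\<And>n. t n \<inter> A = t' n \<inter> A" "qptl_over A \<psi>"
  shows "qptl_sat t \<psi> \<longleftrightarrow> qptl_sat t' \<psi>"
  using assms
proof (induction \<psi> arbitrary: t t' A)
  case (Exists q \<psi>)
  have "trace_upd t q tq n \<inter> insert q A = trace_upd t' q tq n \<inter> insert q A" for tq n
    using Exists.prems(1)[of n] by (auto simp: trace_upd_def)
  from Exists.IH[OF this] show ?case using Exists.prems(2) by simp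
next
  case (Forall q \<psi>)
  have "trace_upd t q tq n \<inter> insert q A = trace_upd t' q tq n \<inter> insert q A" for tq n
    using Forall.prems(1)[of n] by (auto simp: trace_upd_def)
  from Forall.IH[OF this] show ?case using Forall.prems(2) by simp
next
  case (LTL \<phi>)
  then show ?case using ltl_sat_cong[of t A t' \<phi> 0] by simp
qed

section \<open>Translation of counterfactuals\<close>

text \<open>Worlds are numbered: \<open>0\<close> is the reference trace, \<open>1\<close>, \<open>2\<close>, \<open>3\<close> are those quantified in the
  semantics of the operators, and \<open>4\<close> is the world by which an antecedent is weakened. The variable
  \<open>\<langle>j, a\<rangle>\<close> stands for the proposition \<open>a\<close> in world \<open>j\<close>. One template serves both for formulas and
  for their codes.\<close>

fun cf_template ::
  "('f \<Rightarrow> 'f) \<Rightarrow> ('f \<Rightarrow> 'f \<Rightarrow> 'f) \<Rightarrow> (nat \<Rightarrow> 'f \<Rightarrow> 'f) \<Rightarrow> (nat \<Rightarrow> nat \<Rightarrow> 'f) \<Rightarrow>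
   cf_op \<Rightarrow> (nat \<Rightarrow> 'f) \<Rightarrow> (nat \<Rightarrow> 'f) \<Rightarrow> 'f" where
  "cf_template nt an ex le Would A B =
     nt (an (ex 1 (A 1)) (nt (ex 1 (an (A 1) (nt (ex 2 (an (le 2 1) (an (A 2) (nt (B 2))))))))))"
| "cf_template nt an ex le Might A B =
     an (ex 1 (A 1)) (nt (ex 1 (an (A 1) (nt (ex 2 (an (le 2 1) (an (A 2) (B 2))))))))"
| "cf_template nt an ex le Universal_Would A B =
     nt (an (ex 1 (A 1)) (ex 1 (an (A 1) (nt (ex 2 (an (le 2 1) (an (A 2)
       (nt (ex 3 (an (le 3 2) (an (A 3) (nt (B 3)))))))))))))"
| "cf_template nt an ex le Existential_Might A B =
     ex 1 (an (A 1) (nt (ex 2 (an (le 2 1) (an (A 2) (nt (ex 3 (an (le 3 2) (an (A 3) (B 3))))))))))"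

locale qptl_setting =
  fixes AP :: "nat set" and \<phi>\<^sub>U :: "nat qptl" and \<phi>\<^sub>R :: "(nat \<times> nat) qptl"
    and R :: "nat trace \<Rightarrow> nat trace \<Rightarrow> nat trace \<Rightarrow> bool"
  assumes finite_AP: "finite AP"
    and over_U: "qptl_over AP \<phi>\<^sub>U"
    and over_R: "qptl_over (AP \<times> {1, 2, 3}) \<phi>\<^sub>R"
    and R_iff: "\<And>t1 t2 t3. t1 \<in> traces AP \<Longrightarrow> t2 \<in> traces AP \<Longrightarrow> t3 \<in> traces AP \<Longrightarrow>
      R t1 t2 t3 \<longleftrightarrow> qptl_sat (trace_union3 t1 t2 t3) \<phi>\<^sub>R"
begin

section \<open>Formulas about tuples of worlds\<close>

definition U :: "nat trace set" where
  "U = language AP \<phi>\<^sub>U"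

text \<open>An arbitrary but fixed enumeration, so that quantification over a trace is a finite
  block of set quantifiers.\<close>

definition AP_list :: "nat list" where
  "AP_list = (SOME L. set L = AP)"

lemma set_AP_list: "set AP_list = AP"
  unfolding AP_list_def using finite_list[OF finite_AP] by (rule someI_ex)

definition world :: "(nat \<Rightarrow> nat set) \<Rightarrow> nat \<Rightarrow> nat trace" where
  "world e j n = {a \<in> AP. n \<in> e \<langle>j, a\<rangle>}"

lemma world_in_traces: "world e j \<in> traces AP"
  by (auto simp: world_def traces_def)

text \<open>Hides valuations behind the worlds they encode, so that correctness of a template
  follows with one rule per connective.\<close>

definition expresses :: "mso \<Rightarrow> ((nat \<Rightarrow> nat trace) \<Rightarrow> bool) \<Rightarrow> bool" where
  "expresses \<phi> P \<longleftrightarrow> (\<forall>e. holds e \<phi> \<longleftrightarrow> P (world e))"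

lemma expresses_MNot: "expresses \<phi> P \<Longrightarrow> expresses (MNot \<phi>) (\<lambda>w. \<not> P w)"
  by (simp add: expresses_def)

lemma expresses_MAnd: "expresses \<phi> P \<Longrightarrow> expresses \<psi> Q \<Longrightarrow> expresses (MAnd \<phi> \<psi>) (\<lambda>w. P w \<and> Q w)"
  by (simp add: expresses_def)

lemma expresses_cong: "expresses \<phi> P \<Longrightarrow> (\<And>w. P w \<longleftrightarrow> Q w) \<Longrightarrow> expresses \<phi> Q"
  by (simp add: expresses_def)

definition ex_world :: "nat \<Rightarrow> mso \<Rightarrow> mso" where
  "ex_world j \<phi> = foldr (\<lambda>a. MEx \<langle>j, a\<rangle>) AP_list \<phi>"

lemma holds_foldr_MEx:
  "holds e (foldr (\<lambda>a. MEx (v a)) L \<phi>) \<longleftrightarrow> (\<exists>X. holds (override_on e X (v ` set L)) \<phi>)"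
proof (induction L arbitrary: e)
  case (Cons a L)
  have "(\<exists>Y X. holds (override_on (e(v a := Y)) X (v ` set L)) \<phi>) \<longleftrightarrow>
      (\<exists>X. holds (override_on e X (insert (v a) (v ` set L))) \<phi>)"
  proof
    assume "\<exists>Y X. holds (override_on (e(v a := Y)) X (v ` set L)) \<phi>"
    then obtain Y X where *: "holds (override_on (e(v a := Y)) X (v ` set L)) \<phi>" by blast
    \<comment> \<open>A variable may occur twice in the list. The inner quantifier then wins, so
      \<open>Y\<close> is used only if \<open>v a\<close> is not bound again.\<close>
    have eq: "override_on (e(v a := Y)) X (v ` set L)
        = override_on e (override_on (\<lambda>_. Y) X (v ` set L)) (insert (v a) (v ` set L))"
      by (auto simp: override_on_def fun_eq_iff)
    from *[unfolded eq] show "\<exists>X. holds (override_on e X (insert (v a) (v ` set L))) \<phi>"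
      by (intro exI)
  next
    assume "\<exists>X. holds (override_on e X (insert (v a) (v ` set L))) \<phi>"
    then obtain X where *: "holds (override_on e X (insert (v a) (v ` set L))) \<phi>" by blast
    have eq: "override_on e X (insert (v a) (v ` set L)) = override_on (e(v a := X (v a))) X (v ` set L)"
      by (auto simp: override_on_def fun_eq_iff)
    from *[unfolded eq] show "\<exists>Y X. holds (override_on (e(v a := Y)) X (v ` set L)) \<phi>" by (intro exI)
  qed
  then show ?case
    unfolding foldr.simps o_apply holds.simps Cons list.set image_insert .
qed simp

lemma world_override_on:
  "world (override_on e X ((\<lambda>a. \<langle>j, a\<rangle>) ` AP)) = (world e)(j := (\<lambda>n. {a \<in> AP. n \<in> X \<langle>j, a\<rangle>}))"
proof (rule ext)+
  fix i n
  show "world (override_on e X ((\<lambda>a. \<langle>j, a\<rangle>) ` AP)) i n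
      = ((world e)(j := (\<lambda>n. {a \<in> AP. n \<in> X \<langle>j, a\<rangle>}))) i n"
    by (cases "i = j") (auto simp: world_def override_on_def)
qed

lemma expresses_ex_world:
  assumes "expresses \<phi> P"
  shows "expresses (ex_world j \<phi>) (\<lambda>w. \<exists>t\<in>traces AP. P (w(j := t)))"
  unfolding expresses_def
proof
  fix e
  have \<phi>: "holds e \<phi> \<longleftrightarrow> P (world e)" for e
    using assms by (simp add: expresses_def)
  have "holds e (ex_world j \<phi>) \<longleftrightarrow> (\<exists>X. P ((world e)(j := (\<lambda>n. {a \<in> AP. n \<in> X \<langle>j, a\<rangle>}))))"
    unfolding ex_world_def holds_foldr_MEx set_AP_list \<phi> world_override_on ..
  also have "\<dots> \<longleftrightarrow> (\<exists>t\<in>traces AP. P ((world e)(j := t)))"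
  proof
    assume "\<exists>X. P ((world e)(j := (\<lambda>n. {a \<in> AP. n \<in> X \<langle>j, a\<rangle>})))"
    then obtain X where "P ((world e)(j := (\<lambda>n. {a \<in> AP. n \<in> X \<langle>j, a\<rangle>})))" ..
    then show "\<exists>t\<in>traces AP. P ((world e)(j := t))"
      by (intro bexI[of _ "\<lambda>n. {a \<in> AP. n \<in> X \<langle>j, a\<rangle>}"]) (auto simp: traces_def)
  next
    assume "\<exists>t\<in>traces AP. P ((world e)(j := t))"
    then obtain t where t: "t \<in> traces AP" "P ((world e)(j := t))" ..
    have "{a \<in> AP. a \<in> t n} = t n" for n
      using t(1) by (auto simp: traces_def)
    with t(2) show "\<exists>X. P ((world e)(j := (\<lambda>n. {a \<in> AP. n \<in> X \<langle>j, a\<rangle>})))"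
      by (intro exI[of _ "\<lambda>x. {n. psnd x \<in> t n}"]) simp
  qed
  finally show "holds e (ex_world j \<phi>) \<longleftrightarrow> (\<exists>t\<in>traces AP. P ((world e)(j := t)))" .
qed

definition qptl_at :: "nat \<Rightarrow> nat qptl \<Rightarrow> mso" where
  "qptl_at j \<psi> = qptl_mso (\<lambda>a. \<langle>j, a\<rangle>) \<psi>"

lemma expresses_qptl_at:
  assumes "qptl_over AP \<psi>" "j < 5"
  shows "expresses (qptl_at j \<psi>) (\<lambda>w. qptl_sat (w j) \<psi>)"
  unfolding expresses_def
proof
  fix e
  have "holds e (qptl_at j \<psi>) \<longleftrightarrow> qptl_sat (trace_of (\<lambda>a. \<langle>j, a\<rangle>) e) \<psi>"
    unfolding qptl_at_def using assms(2) by (intro holds_qptl_mso) (auto simp: inj_on_def)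
  also have "\<dots> \<longleftrightarrow> qptl_sat (world e j) \<psi>"
    by (rule qptl_sat_cong[OF _ assms(1)]) (auto simp: world_def trace_of_def)
  finally show "holds e (qptl_at j \<psi>) \<longleftrightarrow> qptl_sat (world e j) \<psi>" .
qed

text \<open>Quantified propositions of \<open>\<phi>\<^sub>R\<close> may be any pairs outside
  \<open>AP \<times> {1, 2, 3}\<close>; giving the other indices tag 6 keeps the renaming injective
  and clear of the position variables.\<close>

definition closer :: "nat \<Rightarrow> nat \<Rightarrow> mso" where
  "closer i j = qptl_mso (\<lambda>(a, m). if m = 1 then \<langle>0, a\<rangle> else if m = 2 then \<langle>i, a\<rangle>
     else if m = 3 then \<langle>j, a\<rangle> else \<langle>6, \<langle>a, m\<rangle>\<rangle>) \<phi>\<^sub>R"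

lemma expresses_closer:
  assumes "0 < i" "0 < j" "i \<noteq> j" "i < 5" "j < 5"
  shows "expresses (closer i j) (\<lambda>w. R (w 0) (w i) (w j))"
  unfolding expresses_def
proof
  fix e
  let ?\<rho> = "\<lambda>(a, m). if m = 1 then \<langle>0, a\<rangle> else if m = 2 then \<langle>i, a\<rangle>
     else if m = 3 then \<langle>j, a\<rangle> else \<langle>6, \<langle>a, m\<rangle>\<rangle>"
  have "holds e (closer i j) \<longleftrightarrow> qptl_sat (trace_of ?\<rho> e) \<phi>\<^sub>R"
    unfolding closer_def
  proof (rule holds_qptl_mso)
    show "?\<rho> p \<noteq> pos_var d" for p d
      using assms by (auto split: prod.split)
    show "inj ?\<rho>"
      using assms by (auto simp: inj_on_def split: if_splits)
  qed
  also have "\<dots> \<longleftrightarrow> qptl_sat (trace_union3 (world e 0) (world e i) (world e j)) \<phi>\<^sub>R"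
    by (rule qptl_sat_cong[OF _ over_R]) (auto simp: world_def trace_of_def trace_union3_def)
  also have "\<dots> \<longleftrightarrow> R (world e 0) (world e i) (world e j)"
    using R_iff[OF world_in_traces world_in_traces world_in_traces] by simp
  finally show "holds e (closer i j) \<longleftrightarrow> R (world e 0) (world e i) (world e j)" .
qed

text \<open>\<open>MNot (NotSub 0 0)\<close> is the true formula. Equality of worlds serves to
  weaken an antecedent by a single world.\<close>

definition world_eq :: "nat \<Rightarrow> nat \<Rightarrow> mso" where
  "world_eq i j = foldr (\<lambda>a \<phi>. MAnd (MAnd (MNot (NotSub \<langle>i, a\<rangle> \<langle>j, a\<rangle>)) (MNot (NotSub \<langle>j, a\<rangle> \<langle>i, a\<rangle>))) \<phi>)
     AP_list (MNot (NotSub 0 0))"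

lemma expresses_world_eq: "expresses (world_eq i j) (\<lambda>w. w i = w j)"
  unfolding expresses_def
proof
  fix e
  have "holds e (foldr (\<lambda>a \<phi>. MAnd (MAnd (MNot (NotSub \<langle>i, a\<rangle> \<langle>j, a\<rangle>)) (MNot (NotSub \<langle>j, a\<rangle> \<langle>i, a\<rangle>))) \<phi>)
     L (MNot (NotSub 0 0))) \<longleftrightarrow> (\<forall>a\<in>set L. e \<langle>i, a\<rangle> = e \<langle>j, a\<rangle>)" for L
    by (induction L) auto
  from this[of AP_list] show "holds e (world_eq i j) \<longleftrightarrow> world e i = world e j"
    unfolding world_eq_def set_AP_list by (auto simp: world_def fun_eq_iff set_eq_iff)
qed

definition ex_U :: "nat \<Rightarrow> mso \<Rightarrow> mso" where
  "ex_U j \<phi> = ex_world j (MAnd (qptl_at j \<phi>\<^sub>U) \<phi>)"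

lemma expresses_ex_U:
  assumes "expresses \<phi> P" "j < 5"
  shows "expresses (ex_U j \<phi>) (\<lambda>w. \<exists>t\<in>U. P (w(j := t)))"
  unfolding ex_U_def
  by (rule expresses_cong[OF expresses_ex_world[OF expresses_MAnd[OF expresses_qptl_at[OF over_U assms(2)] assms(1)]]])
    (auto simp: U_def language_def)

abbreviation "cf_formula \<equiv> cf_template MNot MAnd ex_U closer"

text \<open>The template never binds world 4, so the antecedent may refer to it. One result thus
  covers both the original antecedent and the one weakened by a single world.\<close>

lemma expresses_cf_formula:
  assumes A: "\<And>j. 0 < j \<Longrightarrow> j < 4 \<Longrightarrow> expresses (A j) (\<lambda>w. \<phi> (w 4) (w j))"
    and B: "\<And>j. 0 < j \<Longrightarrow> j < 4 \<Longrightarrow> expresses (B j) (\<lambda>w. \<psi> (w j))"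
  shows "expresses (cf_formula c A B) (\<lambda>w. cf_holds U (R (w 0)) c (\<phi> (w 4)) \<psi>)"
proof (cases c)
  case Would
  show ?thesis
    unfolding Would cf_template.simps
    by (rule expresses_cong,
        (rule expresses_MNot expresses_MAnd expresses_ex_U expresses_closer A B | linarith | (rule notI, linarith))+)
      (simp; blast)?
next
  case Might
  show ?thesis
    unfolding Might cf_template.simps
    by (rule expresses_cong,
        (rule expresses_MNot expresses_MAnd expresses_ex_U expresses_closer A B | linarith | (rule notI, linarith))+)
      (simp; blast)?
next
  case Universal_Would
  show ?thesis
    unfolding Universal_Would cf_template.simps
    by (rule expresses_cong,
        (rule expresses_MNot expresses_MAnd expresses_ex_U expresses_closer A B | linarith | (rule notI, linarith))+)
      (simp; blast)?
next
  case Existential_Might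
  show ?thesis
    unfolding Existential_Might cf_template.simps
    by (rule expresses_cong,
        (rule expresses_MNot expresses_MAnd expresses_ex_U expresses_closer A B | linarith | (rule notI, linarith))+)
      (simp; blast)?
qed

abbreviation "qptl_or_eq j \<phi> \<equiv> MNot (MAnd (MNot (qptl_at j \<phi>)) (MNot (world_eq j 4)))"

primrec cf_mso :: "nat qptl_cf \<Rightarrow> mso" where
  "cf_mso (Cf c \<phi> \<psi>) = cf_formula c (\<lambda>j. qptl_at j \<phi>) (\<lambda>j. qptl_at j \<psi>)"
| "cf_mso (Cf_Min c \<phi> \<psi>) = MAnd (cf_formula c (\<lambda>j. qptl_at j \<phi>) (\<lambda>j. qptl_at j \<psi>))
     (MNot (ex_U 4 (MAnd (MNot (qptl_at 4 \<phi>))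
        (cf_formula c (\<lambda>j. qptl_or_eq j \<phi>) (\<lambda>j. qptl_at j \<psi>)))))"
| "cf_mso (Cf_And \<xi> \<zeta>) = MAnd (cf_mso \<xi>) (cf_mso \<zeta>)"
| "cf_mso (Cf_Not \<xi>) = MNot (cf_mso \<xi>)"
| "cf_mso (QPTL \<psi>) = qptl_at 0 \<psi>"

lemma holds_cf_mso:
  assumes "cf_over AP \<xi>" and refl: "reflp_on U (R (world e 0))"
  shows "holds e (cf_mso \<xi>) \<longleftrightarrow> cf_sat U R (world e 0) \<xi>"
  using assms(1)
proof (induction \<xi>)
  case (Cf c \<phi> \<psi>)
  have "expresses (cf_mso (Cf c \<phi> \<psi>))
      (\<lambda>w. cf_holds U (R (w 0)) c (\<lambda>t. qptl_sat t \<phi>) (\<lambda>t. qptl_sat t \<psi>))"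
    unfolding cf_mso.simps using Cf by (intro expresses_cf_formula expresses_qptl_at) simp_all
  then show ?case by (simp add: expresses_def)
next
  case (Cf_Min c \<phi> \<psi>)
  have 1: "expresses (cf_formula c (\<lambda>j. qptl_at j \<phi>) (\<lambda>j. qptl_at j \<psi>))
      (\<lambda>w. cf_holds U (R (w 0)) c (\<lambda>t. qptl_sat t \<phi>) (\<lambda>t. qptl_sat t \<psi>))"
    using Cf_Min by (intro expresses_cf_formula expresses_qptl_at) simp_all
  have "expresses (qptl_or_eq j \<phi>) (\<lambda>w. qptl_sat (w j) \<phi> \<or> w j = w 4)" if "j < 4" for j
    using that Cf_Min.prems
    by (intro expresses_cong[OF expresses_MNot[OF expresses_MAnd[OF expresses_MNot[OF expresses_qptl_at]
      expresses_MNot[OF expresses_world_eq]]]]) auto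
  then have 2: "expresses (cf_formula c (\<lambda>j. qptl_or_eq j \<phi>) (\<lambda>j. qptl_at j \<psi>))
      (\<lambda>w. cf_holds U (R (w 0)) c (\<lambda>t. qptl_sat t \<phi> \<or> t = w 4) (\<lambda>t. qptl_sat t \<psi>))"
    using Cf_Min.prems
    by (intro expresses_cf_formula[where \<phi> = "\<lambda>x t. qptl_sat t \<phi> \<or> t = x"] expresses_qptl_at) simp_all
  have "expresses (cf_mso (Cf_Min c \<phi> \<psi>)) (\<lambda>w. cf_holds U (R (w 0)) c (\<lambda>t. qptl_sat t \<phi>) (\<lambda>t. qptl_sat t \<psi>) \<and>
      \<not> (\<exists>x\<in>U. \<not> qptl_sat x \<phi> \<and> cf_holds U (R (w 0)) c (\<lambda>t. qptl_sat t \<phi> \<or> t = x) (\<lambda>t. qptl_sat t \<psi>)))"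
    unfolding cf_mso.simps using Cf_Min.prems
    by (intro expresses_cong[OF expresses_MAnd[OF 1 expresses_MNot[OF expresses_ex_U[OF
      expresses_MAnd[OF expresses_MNot[OF expresses_qptl_at] 2]]]]]) simp_all
  then show ?case
    unfolding cf_sat.simps cf_min_holds_iff[OF refl] by (simp add: expresses_def)
next
  case (QPTL \<psi>)
  then show ?case using expresses_qptl_at[of \<psi> 0] by (simp add: expresses_def)
qed simp_all

end

section \<open>Computing types and acceptance\<close>

text \<open>The code of \<open>MEx x \<phi>\<close> contains \<open>2 ^ x\<close>, so that setting the bit \<open>x\<close> of a letter \<open>a\<close> makes
  the code of \<open>a\<close> grow by less than the code of the formula shrinks. This turns the recursion of
  \<open>letter_type\<close> into a course-of-values recursion.\<close>

primrec mso_code :: "mso \<Rightarrow> nat" where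
  "mso_code (NotSub x y) = \<langle>0, \<langle>x, y\<rangle>\<rangle>"
| "mso_code (Before x y) = \<langle>1, \<langle>x, y\<rangle>\<rangle>"
| "mso_code (MNot \<phi>) = \<langle>2, mso_code \<phi>\<rangle>"
| "mso_code (MAnd \<phi> \<psi>) = \<langle>3, \<langle>mso_code \<phi>, mso_code \<psi>\<rangle>\<rangle>"
| "mso_code (MEx x \<phi>) = \<langle>4, \<langle>2 ^ x, mso_code \<phi>\<rangle>\<rangle>"

text \<open>A formula code provides \<open>2 ^ x\<close> rather than \<open>x\<close>; its only bit
  is found by bounded search.\<close>

definition has_bit :: "nat \<Rightarrow> nat \<Rightarrow> bool" where
  "has_bit m a \<longleftrightarrow> (\<exists>x<m. x \<in> set_decode m \<and> x \<in> set_decode a)"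

lemma has_bit_power:
  assumes "finite a"
  shows "has_bit (2 ^ x) (set_encode a) \<longleftrightarrow> x \<in> a"
  using assms unfolding has_bit_def set_decode_power by auto

lemma set_encode_insert_code:
  assumes "finite a"
  shows "set_encode (insert x a) = (if has_bit (2 ^ x) (set_encode a) then set_encode a else set_encode a + 2 ^ x)"
  using assms by (simp add: has_bit_power insert_absorb)

lemma set_encode_remove_code:
  assumes "finite a"
  shows "set_encode (a - {x}) = (if has_bit (2 ^ x) (set_encode a) then set_encode a - 2 ^ x else set_encode a)"
proof (cases "x \<in> a")
  case True
  then have "set_encode a = 2 ^ x + set_encode (a - {x})"
    using assms set_encode_insert[of "a - {x}" x] by (simp add: insert_absorb)
  moreover have "has_bit (2 ^ x) (set_encode a)"
    using True assms by (simp add: has_bit_power)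
  ultimately show ?thesis by simp
qed (use assms in \<open>simp add: has_bit_power\<close>)

lemma set_encode_doubleton: "set_encode {x, y} = (if x = y then 2 ^ x else 2 ^ x + 2 ^ y)"
  by simp

lemma computable_letter_type:
  obtains F where "computable F"
    "\<And>\<phi> a. finite a \<Longrightarrow> F \<langle>mso_code \<phi>, set_encode a\<rangle> = letter_type \<phi> a"
proof -
  define H :: "(nat \<Rightarrow> nat) \<Rightarrow> nat \<Rightarrow> nat" where
    "H r z = (if pfst (pfst z) = 0 then
        of_bool (pfst (psnd (pfst z)) \<in> set_decode (psnd z) \<and> \<not> psnd (psnd (pfst z)) \<in> set_decode (psnd z))
      else if pfst (pfst z) = 1 then
        \<langle>of_bool (pfst (psnd (pfst z)) \<in> set_decode (psnd z)),
         \<langle>of_bool (psnd (psnd (pfst z)) \<in> set_decode (psnd z)), 0\<rangle>\<rangle>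
      else if pfst (pfst z) = 2 then r \<langle>psnd (pfst z), psnd z\<rangle>
      else if pfst (pfst z) = 3 then
        \<langle>r \<langle>pfst (psnd (pfst z)), psnd z\<rangle>, r \<langle>psnd (psnd (pfst z)), psnd z\<rangle>\<rangle>
      else if has_bit (pfst (psnd (pfst z))) (psnd z) then
        if r \<langle>psnd (psnd (pfst z)), psnd z - pfst (psnd (pfst z))\<rangle> = r \<langle>psnd (psnd (pfst z)), psnd z\<rangle>
        then 2 ^ r \<langle>psnd (psnd (pfst z)), psnd z\<rangle>
        else 2 ^ r \<langle>psnd (psnd (pfst z)), psnd z - pfst (psnd (pfst z))\<rangle> + 2 ^ r \<langle>psnd (psnd (pfst z)), psnd z\<rangle>
      else
        if r \<langle>psnd (psnd (pfst z)), psnd z\<rangle> = r \<langle>psnd (psnd (pfst z)), psnd z + pfst (psnd (pfst z))\<rangle>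
        then 2 ^ r \<langle>psnd (psnd (pfst z)), psnd z\<rangle>
        else 2 ^ r \<langle>psnd (psnd (pfst z)), psnd z\<rangle> + 2 ^ r \<langle>psnd (psnd (pfst z)), psnd z + pfst (psnd (pfst z))\<rangle>)"
    for r z
  have "computable (\<lambda>z. H (table_lookup (pfst z) (psnd z)) (pfst z))"
    unfolding H_def has_bit_def by (intro computable_intros)
  then obtain F where F: "computable F" "\<And>x. F x = H (\<lambda>y. if y < x then F y else 0) x"
    by (rule computable_course_of_values) (rule that, assumption+)
  have "F \<langle>mso_code \<phi>, set_encode a\<rangle> = letter_type \<phi> a" if "finite a" for \<phi> a
    using that
  proof (induction \<phi> arbitrary: a)
    case (NotSub x y)
    then show ?case by (subst F(2)) (simp add: H_def)
  next
    case (Before x y)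
    then show ?case by (subst F(2)) (simp add: H_def)
  next
    case (MNot \<phi>)
    have "\<langle>mso_code \<phi>, set_encode a\<rangle> < \<langle>mso_code (MNot \<phi>), set_encode a\<rangle>"
      using pair_ge[of 2 "mso_code \<phi>"] by (intro pair_less) simp
    then show ?case using MNot by (subst F(2)) (simp add: H_def)
  next
    case (MAnd \<phi> \<psi>)
    have "\<langle>mso_code \<phi>, set_encode a\<rangle> < \<langle>mso_code (MAnd \<phi> \<psi>), set_encode a\<rangle>"
      "\<langle>mso_code \<psi>, set_encode a\<rangle> < \<langle>mso_code (MAnd \<phi> \<psi>), set_encode a\<rangle>"
      using pair_ge[of 3 "\<langle>mso_code \<phi>, mso_code \<psi>\<rangle>"] pair_ge[of "mso_code \<phi>" "mso_code \<psi>"]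
      by (intro pair_less; simp)+
    then show ?case using MAnd by (subst F(2)) (simp add: H_def)
  next
    case (MEx x \<phi>)
    have "\<langle>mso_code \<phi>, set_encode a\<rangle> < \<langle>mso_code (MEx x \<phi>), set_encode a\<rangle>"
      "\<langle>mso_code \<phi>, set_encode a - 2 ^ x\<rangle> < \<langle>mso_code (MEx x \<phi>), set_encode a\<rangle>"
      "\<langle>mso_code \<phi>, set_encode a + 2 ^ x\<rangle> < \<langle>mso_code (MEx x \<phi>), set_encode a\<rangle>"
      using pair_ge[of 4 "\<langle>2 ^ x, mso_code \<phi>\<rangle>"] pair_ge[of "2 ^ x" "mso_code \<phi>"]
      by (intro pair_less; simp)+
    moreover have "F \<langle>mso_code \<phi>, set_encode (insert x a)\<rangle> = letter_type \<phi> (insert x a)"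
      "F \<langle>mso_code \<phi>, set_encode (a - {x})\<rangle> = letter_type \<phi> (a - {x})"
      using MEx by simp_all
    ultimately show ?case
      using MEx.prems unfolding letter_type.simps set_encode_doubleton
      by (subst F(2)) (auto simp: H_def set_encode_insert_code set_encode_remove_code split: if_splits
          simp del: set_encode_insert)
  qed
  with F(1) show ?thesis using that by blast
qed

text \<open>Elements of a coded set are below its code, so each pair of elements is below the pair
  of the two codes. The product of two sets is therefore a bounded collection over coded pairs, and
  such a pair is itself the argument of the recursive call.\<close>

lemma computable_type_mult:
  obtains F where "computable F" "\<And>\<phi> s t. F \<langle>mso_code \<phi>, \<langle>s, t\<rangle>\<rangle> = type_mult \<phi> s t"
proof -
  define H :: "(nat \<Rightarrow> nat) \<Rightarrow> nat \<Rightarrow> nat" where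
    "H r z = (if pfst (pfst z) = 0 then max (pfst (psnd z)) (psnd (psnd z))
      else if pfst (pfst z) = 1 then
        \<langle>max (pfst (pfst (psnd z))) (pfst (psnd (psnd z))),
         \<langle>max (pfst (psnd (pfst (psnd z)))) (pfst (psnd (psnd (psnd z)))),
          max (max (psnd (psnd (pfst (psnd z)))) (psnd (psnd (psnd (psnd z)))))
            (min (pfst (pfst (psnd z))) (pfst (psnd (psnd (psnd z)))))\<rangle>\<rangle>
      else if pfst (pfst z) = 2 then r \<langle>psnd (pfst z), psnd z\<rangle>
      else if pfst (pfst z) = 3 then
        \<langle>r \<langle>pfst (psnd (pfst z)), \<langle>pfst (pfst (psnd z)), pfst (psnd (psnd z))\<rangle>\<rangle>,
         r \<langle>psnd (psnd (pfst z)), \<langle>psnd (pfst (psnd z)), psnd (psnd (psnd z))\<rangle>\<rangle>\<rangle>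
      else set_encode {r \<langle>psnd (psnd (pfst z)), i\<rangle> |i. i < psnd z \<and>
        (pfst i \<in> set_decode (pfst (psnd z)) \<and> psnd i \<in> set_decode (psnd (psnd z)))})"
    for r z
  have "computable (\<lambda>z. H (table_lookup (pfst z) (psnd z)) (pfst z))"
    unfolding H_def by (intro computable_intros)
  then obtain F where F: "computable F" "\<And>x. F x = H (\<lambda>y. if y < x then F y else 0) x"
    by (rule computable_course_of_values) (rule that, assumption+)
  have "F \<langle>mso_code \<phi>, \<langle>s, t\<rangle>\<rangle> = type_mult \<phi> s t" for \<phi> s t
  proof (induction \<phi> arbitrary: s t)
    case (NotSub x y)
    then show ?case by (subst F(2)) (simp add: H_def)
  next
    case (Before x y)
    then show ?case by (subst F(2)) (simp add: H_def)
  next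
    case (MNot \<phi>)
    have "\<langle>mso_code \<phi>, \<langle>s, t\<rangle>\<rangle> < \<langle>mso_code (MNot \<phi>), \<langle>s, t\<rangle>\<rangle>"
      using pair_ge[of 2 "mso_code \<phi>"] by (intro pair_less) simp
    then show ?case using MNot by (subst F(2)) (simp add: H_def)
  next
    case (MAnd \<phi> \<psi>)
    have "\<langle>pfst s, pfst t\<rangle> \<le> \<langle>s, t\<rangle>" "\<langle>psnd s, psnd t\<rangle> \<le> \<langle>s, t\<rangle>"
      by (intro pair_mono pfst_le psnd_le)+
    then have "\<langle>mso_code \<phi>, \<langle>pfst s, pfst t\<rangle>\<rangle> < \<langle>mso_code (MAnd \<phi> \<psi>), \<langle>s, t\<rangle>\<rangle>"
      "\<langle>mso_code \<psi>, \<langle>psnd s, psnd t\<rangle>\<rangle> < \<langle>mso_code (MAnd \<phi> \<psi>), \<langle>s, t\<rangle>\<rangle>"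
      using pair_ge[of 3 "\<langle>mso_code \<phi>, mso_code \<psi>\<rangle>"] pair_ge[of "mso_code \<phi>" "mso_code \<psi>"]
      by (intro pair_less; simp)+
    then show ?case using MAnd by (subst F(2)) (simp add: H_def)
  next
    case (MEx x \<phi>)
    have less: "\<langle>mso_code \<phi>, i\<rangle> < \<langle>mso_code (MEx x \<phi>), \<langle>s, t\<rangle>\<rangle>" if "i < \<langle>s, t\<rangle>" for i
      using that pair_ge[of 4 "\<langle>2 ^ x, mso_code \<phi>\<rangle>"] pair_ge[of "2 ^ x" "mso_code \<phi>"]
      by (intro pair_less) simp
    let ?P = "\<lambda>i. i < \<langle>s, t\<rangle> \<and> (pfst i \<in> set_decode s \<and> psnd i \<in> set_decode t)"
    have "F \<langle>mso_code (MEx x \<phi>), \<langle>s, t\<rangle>\<rangle> = set_encode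
        {if \<langle>mso_code \<phi>, i\<rangle> < \<langle>mso_code (MEx x \<phi>), \<langle>s, t\<rangle>\<rangle> then F \<langle>mso_code \<phi>, i\<rangle> else 0 |i. ?P i}"
      by (subst F(2)) (simp add: H_def)
    \<comment> \<open>Every lookup in this range is smaller than the current argument, so the
      default 0 never occurs.\<close>
    also have "{if \<langle>mso_code \<phi>, i\<rangle> < \<langle>mso_code (MEx x \<phi>), \<langle>s, t\<rangle>\<rangle> then F \<langle>mso_code \<phi>, i\<rangle> else 0 |i. ?P i}
        = {F \<langle>mso_code \<phi>, i\<rangle> |i. ?P i}"
      using less by (intro Collect_cong ex_cong1) (auto simp del: mso_code.simps)
    also have "\<dots> = {type_mult \<phi> a b |a b. a \<in> set_decode s \<and> b \<in> set_decode t}"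
    proof (intro equalityI subsetI)
      fix y assume "y \<in> {F \<langle>mso_code \<phi>, i\<rangle> |i. ?P i}"
      then obtain i where i: "y = F \<langle>mso_code \<phi>, i\<rangle>" "?P i" by blast
      have "y = type_mult \<phi> (pfst i) (psnd i)"
        using i(1) MEx[of "pfst i" "psnd i"] by simp
      with i(2) show "y \<in> {type_mult \<phi> a b |a b. a \<in> set_decode s \<and> b \<in> set_decode t}" by blast
    next
      fix y assume "y \<in> {type_mult \<phi> a b |a b. a \<in> set_decode s \<and> b \<in> set_decode t}"
      then obtain a b where ab: "y = type_mult \<phi> a b" "a \<in> set_decode s" "b \<in> set_decode t" by blast
      then have "\<langle>a, b\<rangle> < \<langle>s, t\<rangle>"
        by (intro pair_less add_strict_mono set_decode_less)
      then have "?P \<langle>a, b\<rangle>" using ab by simp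
      moreover have "y = F \<langle>mso_code \<phi>, \<langle>a, b\<rangle>\<rangle>" using ab MEx by simp
      ultimately show "y \<in> {F \<langle>mso_code \<phi>, i\<rangle> |i. ?P i}" by blast
    qed
    finally show ?case by simp
  qed
  with F(1) show ?thesis using that by blast
qed

text \<open>The quantifier case is a bounded search over the same coded pairs as in the product of
  types; the linking equations are tested with the computable multiplication.\<close>

lemma computable_accepts:
  obtains F where "computable F" "\<And>\<phi> s e. F \<langle>mso_code \<phi>, \<langle>s, e\<rangle>\<rangle> = of_bool (accepts \<phi> s e)"
proof -
  obtain M where M: "computable M" "\<And>\<phi> s t. M \<langle>mso_code \<phi>, \<langle>s, t\<rangle>\<rangle> = type_mult \<phi> s t"
    using computable_type_mult by blast
  define H :: "(nat \<Rightarrow> nat) \<Rightarrow> nat \<Rightarrow> nat" where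
    "H r z = (if pfst (pfst z) = 0 then of_bool (pfst (psnd z) = 1)
      else if pfst (pfst z) = 1 then of_bool (psnd (psnd (pfst (psnd z))) = 1)
      else if pfst (pfst z) = 2 then of_bool (r \<langle>psnd (pfst z), psnd z\<rangle> = 0)
      else if pfst (pfst z) = 3 then
        of_bool (r \<langle>pfst (psnd (pfst z)), \<langle>pfst (pfst (psnd z)), pfst (psnd (psnd z))\<rangle>\<rangle> = 1 \<and>
         r \<langle>psnd (psnd (pfst z)), \<langle>psnd (pfst (psnd z)), psnd (psnd (psnd z))\<rangle>\<rangle> = 1)
      else of_bool (\<exists>i<psnd z. pfst i \<in> set_decode (pfst (psnd z)) \<and> psnd i \<in> set_decode (psnd (psnd z)) \<and>
        M \<langle>psnd (psnd (pfst z)), i\<rangle> = pfst i \<and> M \<langle>psnd (psnd (pfst z)), \<langle>psnd i, psnd i\<rangle>\<rangle> = psnd i \<and>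
        r \<langle>psnd (psnd (pfst z)), i\<rangle> = 1))"
    for r z
  have "computable (\<lambda>z. H (table_lookup (pfst z) (psnd z)) (pfst z))"
    unfolding H_def by (intro computable_intros computable_comp[OF M(1)])
  then obtain F where F: "computable F" "\<And>x. F x = H (\<lambda>y. if y < x then F y else 0) x"
    by (rule computable_course_of_values) (rule that, assumption+)
  have "F \<langle>mso_code \<phi>, \<langle>s, e\<rangle>\<rangle> = of_bool (accepts \<phi> s e)" for \<phi> s e
  proof (induction \<phi> arbitrary: s e)
    case (NotSub x y)
    then show ?case by (subst F(2)) (simp add: H_def)
  next
    case (Before x y)
    then show ?case by (subst F(2)) (simp add: H_def)
  next
    case (MNot \<phi>)
    have "\<langle>mso_code \<phi>, \<langle>s, e\<rangle>\<rangle> < \<langle>mso_code (MNot \<phi>), \<langle>s, e\<rangle>\<rangle>"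
      using pair_ge[of 2 "mso_code \<phi>"] by (intro pair_less) simp
    then show ?case using MNot by (subst F(2)) (simp add: H_def)
  next
    case (MAnd \<phi> \<psi>)
    have "\<langle>pfst s, pfst e\<rangle> \<le> \<langle>s, e\<rangle>" "\<langle>psnd s, psnd e\<rangle> \<le> \<langle>s, e\<rangle>"
      by (intro pair_mono pfst_le psnd_le)+
    then have "\<langle>mso_code \<phi>, \<langle>pfst s, pfst e\<rangle>\<rangle> < \<langle>mso_code (MAnd \<phi> \<psi>), \<langle>s, e\<rangle>\<rangle>"
      "\<langle>mso_code \<psi>, \<langle>psnd s, psnd e\<rangle>\<rangle> < \<langle>mso_code (MAnd \<phi> \<psi>), \<langle>s, e\<rangle>\<rangle>"
      using pair_ge[of 3 "\<langle>mso_code \<phi>, mso_code \<psi>\<rangle>"] pair_ge[of "mso_code \<phi>" "mso_code \<psi>"]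
      by (intro pair_less; simp)+
    then show ?case using MAnd by (subst F(2)) (simp add: H_def)
  next
    case (MEx x \<phi>)
    have less: "\<langle>mso_code \<phi>, i\<rangle> < \<langle>mso_code (MEx x \<phi>), \<langle>s, e\<rangle>\<rangle>" if "i < \<langle>s, e\<rangle>" for i
      using that pair_ge[of 4 "\<langle>2 ^ x, mso_code \<phi>\<rangle>"] pair_ge[of "2 ^ x" "mso_code \<phi>"]
      by (intro pair_less) simp
    have "F \<langle>mso_code (MEx x \<phi>), \<langle>s, e\<rangle>\<rangle> = of_bool (\<exists>i<\<langle>s, e\<rangle>. pfst i \<in> set_decode s \<and> psnd i \<in> set_decode e \<and>
        M \<langle>mso_code \<phi>, i\<rangle> = pfst i \<and> M \<langle>mso_code \<phi>, \<langle>psnd i, psnd i\<rangle>\<rangle> = psnd i \<and>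
        (if \<langle>mso_code \<phi>, i\<rangle> < \<langle>mso_code (MEx x \<phi>), \<langle>s, e\<rangle>\<rangle> then F \<langle>mso_code \<phi>, i\<rangle> else 0) = 1)"
      by (subst F(2)) (simp add: H_def)
    also have "(\<exists>i<\<langle>s, e\<rangle>. pfst i \<in> set_decode s \<and> psnd i \<in> set_decode e \<and>
        M \<langle>mso_code \<phi>, i\<rangle> = pfst i \<and> M \<langle>mso_code \<phi>, \<langle>psnd i, psnd i\<rangle>\<rangle> = psnd i \<and>
        (if \<langle>mso_code \<phi>, i\<rangle> < \<langle>mso_code (MEx x \<phi>), \<langle>s, e\<rangle>\<rangle> then F \<langle>mso_code \<phi>, i\<rangle> else 0) = 1)
      \<longleftrightarrow> accepts (MEx x \<phi>) s e" (is "?L \<longleftrightarrow> ?R")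
    proof
      assume ?L
      then obtain i where i: "i < \<langle>s, e\<rangle>" "pfst i \<in> set_decode s" "psnd i \<in> set_decode e"
        "M \<langle>mso_code \<phi>, i\<rangle> = pfst i" "M \<langle>mso_code \<phi>, \<langle>psnd i, psnd i\<rangle>\<rangle> = psnd i" "F \<langle>mso_code \<phi>, i\<rangle> = 1"
        by (auto split: if_splits)
      have "type_mult \<phi> (pfst i) (psnd i) = pfst i" "type_mult \<phi> (psnd i) (psnd i) = psnd i"
        using i(4,5) M(2)[of \<phi> "pfst i" "psnd i"] M(2)[of \<phi> "psnd i" "psnd i"] by simp_all
      moreover have "of_bool (accepts \<phi> (pfst i) (psnd i)) = F \<langle>mso_code \<phi>, i\<rangle>"
        using MEx[of "pfst i" "psnd i"] by simp
      then have "accepts \<phi> (pfst i) (psnd i)"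
        unfolding i(6) by (simp only: of_bool_eq_1_iff)
      ultimately show ?R using i(2,3) unfolding accepts.simps by blast
    next
      assume ?R
      then obtain a b where ab: "a \<in> set_decode s" "b \<in> set_decode e"
        "type_mult \<phi> a b = a" "type_mult \<phi> b b = b" "accepts \<phi> a b" by auto
      then have "\<langle>a, b\<rangle> < \<langle>s, e\<rangle>"
        by (intro pair_less add_strict_mono set_decode_less)
      then show ?L
        using ab less[of "\<langle>a, b\<rangle>"] by (intro exI[of _ "\<langle>a, b\<rangle>"]) (simp add: M MEx del: mso_code.simps)
    qed
    finally show ?case .
  qed
  with F(1) show ?thesis using that by blast
qed

section \<open>Computing the translation\<close>

abbreviation NotSub_code :: "nat \<Rightarrow> nat \<Rightarrow> nat" where "NotSub_code x y \<equiv> \<langle>0, \<langle>x, y\<rangle>\<rangle>"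
abbreviation Before_code :: "nat \<Rightarrow> nat \<Rightarrow> nat" where "Before_code x y \<equiv> \<langle>1, \<langle>x, y\<rangle>\<rangle>"
abbreviation MNot_code :: "nat \<Rightarrow> nat" where "MNot_code c \<equiv> \<langle>2, c\<rangle>"
abbreviation MAnd_code :: "nat \<Rightarrow> nat \<Rightarrow> nat" where "MAnd_code c d \<equiv> \<langle>3, \<langle>c, d\<rangle>\<rangle>"
abbreviation MEx_code :: "nat \<Rightarrow> nat \<Rightarrow> nat" where "MEx_code x c \<equiv> \<langle>4, \<langle>2 ^ x, c\<rangle>\<rangle>"

definition sing_code :: "nat \<Rightarrow> nat" where
  "sing_code x = MAnd_code (MNot_code (Before_code x x)) (MEx_code (Suc x) (NotSub_code x (Suc x)))"

lemma mso_code_sing: "mso_code (sing x) = sing_code x"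
  by (simp add: sing_def sing_code_def)

definition Next_code :: "nat \<Rightarrow> nat \<Rightarrow> nat" where
  "Next_code d c = MEx_code (pos_var (d + 1)) (MAnd_code (sing_code (pos_var (d + 1)))
     (MAnd_code (Before_code (pos_var d) (pos_var (d + 1)))
     (MAnd_code (MNot_code (MEx_code (pos_var (d + 2)) (MAnd_code (sing_code (pos_var (d + 2)))
        (MAnd_code (Before_code (pos_var d) (pos_var (d + 2))) (Before_code (pos_var (d + 2)) (pos_var (d + 1)))))))
     c)))"

definition Until_code :: "nat \<Rightarrow> nat \<Rightarrow> nat \<Rightarrow> nat" where
  "Until_code d c c' = MEx_code (pos_var (d + 1)) (MAnd_code (sing_code (pos_var (d + 1)))
     (MAnd_code (MNot_code (Before_code (pos_var (d + 1)) (pos_var d)))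
     (MAnd_code c'
     (MNot_code (MEx_code (pos_var (d + 2)) (MAnd_code (sing_code (pos_var (d + 2)))
        (MAnd_code (MNot_code (Before_code (pos_var (d + 2)) (pos_var d)))
        (MAnd_code (Before_code (pos_var (d + 2)) (pos_var (d + 1))) (MNot_code c)))))))))"

lemma mso_code_Next: "mso_code (ltl_mso \<rho> (Next \<phi>) d) = Next_code d (mso_code (ltl_mso \<rho> \<phi> (d + 1)))"
  by (simp add: Next_code_def mso_code_sing)

lemma mso_code_Until: "mso_code (ltl_mso \<rho> (Until \<phi> \<psi>) d)
    = Until_code d (mso_code (ltl_mso \<rho> \<phi> (d + 2))) (mso_code (ltl_mso \<rho> \<psi> (d + 1)))"
  by (simp add: Until_code_def mso_code_sing)

text \<open>Recursive calls raise the depth by at most 2, but the tags 3 and 4 of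
  \<open>Next\<close> and \<open>Until\<close> contribute more to the formula code than the depth
  gains. The sum of the two arguments therefore falls.\<close>

lemma computable_ltl_mso:
  obtains F where "computable F"
    "\<And>\<phi> d. F \<langle>ltl_code \<phi>, d\<rangle> = mso_code (ltl_mso (\<lambda>a. \<langle>j, a\<rangle>) \<phi> d)"
proof -
  define H :: "(nat \<Rightarrow> nat) \<Rightarrow> nat \<Rightarrow> nat" where
    "H r z = (if pfst (pfst z) = 0 then MNot_code (NotSub_code (pos_var (psnd z)) \<langle>j, psnd (pfst z)\<rangle>)
      else if pfst (pfst z) = 1 then MNot_code (r \<langle>psnd (pfst z), psnd z\<rangle>)
      else if pfst (pfst z) = 2 then
        MAnd_code (r \<langle>pfst (psnd (pfst z)), psnd z\<rangle>) (r \<langle>psnd (psnd (pfst z)), psnd z\<rangle>)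
      else if pfst (pfst z) = 3 then Next_code (psnd z) (r \<langle>psnd (pfst z), psnd z + 1\<rangle>)
      else Until_code (psnd z) (r \<langle>pfst (psnd (pfst z)), psnd z + 2\<rangle>) (r \<langle>psnd (psnd (pfst z)), psnd z + 1\<rangle>))"
    for r z
  have "computable (\<lambda>z. H (table_lookup (pfst z) (psnd z)) (pfst z))"
    unfolding H_def Next_code_def Until_code_def sing_code_def by (intro computable_intros)
  then obtain F where F: "computable F" "\<And>x. F x = H (\<lambda>y. if y < x then F y else 0) x"
    by (rule computable_course_of_values) (rule that, assumption+)
  have "F \<langle>ltl_code \<phi>, d\<rangle> = mso_code (ltl_mso (\<lambda>a. \<langle>j, a\<rangle>) \<phi> d)" for \<phi> d
  proof (induction \<phi> arbitrary: d)
    case (Atom a)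
    show ?case by (subst F(2)) (simp add: H_def)
  next
    case (Neg \<phi>)
    have "\<langle>ltl_code \<phi>, d\<rangle> < \<langle>ltl_code (Neg \<phi>), d\<rangle>"
      using pair_ge[of 1 "ltl_code \<phi>"] by (intro pair_less) simp
    then show ?case using Neg by (subst F(2)) (simp add: H_def)
  next
    case (Conj \<phi> \<psi>)
    have "\<langle>ltl_code \<phi>, d\<rangle> < \<langle>ltl_code (Conj \<phi> \<psi>), d\<rangle>" "\<langle>ltl_code \<psi>, d\<rangle> < \<langle>ltl_code (Conj \<phi> \<psi>), d\<rangle>"
      using pair_ge[of 2 "\<langle>ltl_code \<phi>, ltl_code \<psi>\<rangle>"] pair_ge[of "ltl_code \<phi>" "ltl_code \<psi>"]
      by (intro pair_less; simp)+
    then show ?case using Conj by (subst F(2)) (simp add: H_def)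
  next
    case (Next \<phi>)
    have "\<langle>ltl_code \<phi>, d + 1\<rangle> < \<langle>ltl_code (Next \<phi>), d\<rangle>"
      using pair_ge[of 3 "ltl_code \<phi>"] by (intro pair_less) simp
    then show ?case using Next unfolding mso_code_Next by (subst F(2)) (simp add: H_def)
  next
    case (Until \<phi> \<psi>)
    have "\<langle>ltl_code \<phi>, d + 2\<rangle> < \<langle>ltl_code (Until \<phi> \<psi>), d\<rangle>" "\<langle>ltl_code \<psi>, d + 1\<rangle> < \<langle>ltl_code (Until \<phi> \<psi>), d\<rangle>"
      using pair_ge[of 4 "\<langle>ltl_code \<phi>, ltl_code \<psi>\<rangle>"] pair_ge[of "ltl_code \<phi>" "ltl_code \<psi>"]
      by (intro pair_less; simp)+
    then show ?case using Until unfolding mso_code_Until by (subst F(2)) (simp add: H_def)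
  qed
  with F(1) show ?thesis using that by blast
qed

text \<open>Under the tag 0 of \<open>Exists\<close> the outer pairing is only known not to
  decrease, so strictness must come from the inner pair, which is strictly larger once its sum is at
  least 2.\<close>

lemma qptl_code_ge_2: "2 \<le> qptl_code \<psi>"
proof (induction \<psi>)
  case (Exists q \<psi>)
  then show ?case
    using pair_ge[of 0 "\<langle>q, qptl_code \<psi>\<rangle>"] pair_ge[of q "qptl_code \<psi>"] by simp
next
  case (Forall q \<psi>)
  then show ?case
    using pair_ge[of 1 "\<langle>q, qptl_code \<psi>\<rangle>"] pair_ge[of q "qptl_code \<psi>"] by simp
next
  case (LTL \<phi>)
  show ?case using pair_ge[of 2 "ltl_code \<phi>"] by simp
qed

lemma computable_qptl_mso:
  obtains F where "computable F" "\<And>\<psi>. F (qptl_code \<psi>) = mso_code (qptl_mso (\<lambda>a. \<langle>j, a\<rangle>) \<psi>)"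
proof -
  obtain L where L: "computable L"
    "\<And>\<phi> d. L \<langle>ltl_code \<phi>, d\<rangle> = mso_code (ltl_mso (\<lambda>a. \<langle>j, a\<rangle>) \<phi> d)"
    using computable_ltl_mso by blast
  define H :: "(nat \<Rightarrow> nat) \<Rightarrow> nat \<Rightarrow> nat" where
    "H r z = (if pfst z = 0 then MEx_code \<langle>j, pfst (psnd z)\<rangle> (r (psnd (psnd z)))
      else if pfst z = 1 then MNot_code (MEx_code \<langle>j, pfst (psnd z)\<rangle> (MNot_code (r (psnd (psnd z)))))
      else MEx_code (pos_var 0) (MAnd_code (sing_code (pos_var 0))
        (MAnd_code (MNot_code (MEx_code (pos_var 1) (Before_code (pos_var 1) (pos_var 0)))) (L \<langle>psnd z, 0\<rangle>))))"
    for r z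
  have "computable (\<lambda>z. H (table_lookup (pfst z) (psnd z)) (pfst z))"
    unfolding H_def by (intro computable_intros computable_comp[OF L(1)])
  then obtain F where F: "computable F" "\<And>x. F x = H (\<lambda>y. if y < x then F y else 0) x"
    by (rule computable_course_of_values) (rule that, assumption+)
  have "F (qptl_code \<psi>) = mso_code (qptl_mso (\<lambda>a. \<langle>j, a\<rangle>) \<psi>)" for \<psi>
  proof (induction \<psi>)
    case (Exists q \<psi>)
    have "qptl_code \<psi> < qptl_code (Exists q \<psi>)"
      using pair_greater[of q "qptl_code \<psi>"] pair_ge[of 0 "\<langle>q, qptl_code \<psi>\<rangle>"] qptl_code_ge_2[of \<psi>] by simp
    then show ?case using Exists by (subst F(2)) (simp add: H_def)
  next
    case (Forall q \<psi>)
    have "qptl_code \<psi> < qptl_code (Forall q \<psi>)"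
      using pair_ge[of q "qptl_code \<psi>"] pair_ge[of 1 "\<langle>q, qptl_code \<psi>\<rangle>"] by simp
    then show ?case using Forall by (subst F(2)) (simp add: H_def)
  next
    case (LTL \<phi>)
    show ?case by (subst F(2)) (simp add: H_def L mso_code_sing)
  qed
  with F(1) show ?thesis using that by blast
qed

section \<open>Codes of the formulas for counterfactuals\<close>

context qptl_setting
begin

text \<open>\<open>AP_list\<close> and \<open>\<phi>\<^sub>U\<close> are fixed, so the code of the
  universe formula is a constant and the quantifier block is a fixed composition of
  pairings.\<close>

definition ex_U_code :: "nat \<Rightarrow> nat \<Rightarrow> nat" where
  "ex_U_code j c = foldr (\<lambda>a. MEx_code \<langle>j, a\<rangle>) AP_list (MAnd_code (mso_code (qptl_at j \<phi>\<^sub>U)) c)"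

lemma mso_code_ex_U: "mso_code (ex_U j \<phi>) = ex_U_code j (mso_code \<phi>)"
proof -
  have "mso_code (foldr (\<lambda>a. MEx \<langle>j, a\<rangle>) L \<psi>) = foldr (\<lambda>a. MEx_code \<langle>j, a\<rangle>) L (mso_code \<psi>)" for L \<psi>
    by (induction L) simp_all
  then show ?thesis
    by (simp add: ex_U_def ex_world_def ex_U_code_def)
qed

lemma computable_ex_U_code:
  assumes "computable f"
  shows "computable (\<lambda>x. ex_U_code j (f x))"
proof -
  have foldr: "computable (\<lambda>x. foldr (\<lambda>a. MEx_code \<langle>j, a\<rangle>) L (g x))" if "computable g" for g L
    using that
  proof (induction L)
    case (Cons a L)
    then show ?case unfolding foldr.simps o_apply by (intro computable_pair computable_const)
  qed simp
  show ?thesis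
    unfolding ex_U_code_def using assms by (intro foldr computable_pair computable_const)
qed

abbreviation "cf_formula_code \<equiv> cf_template MNot_code MAnd_code ex_U_code (\<lambda>i j. mso_code (closer i j))"

lemma mso_code_cf_formula:
  "mso_code (cf_formula c A B) = cf_formula_code c (\<lambda>j. mso_code (A j)) (\<lambda>j. mso_code (B j))"
  by (cases c) (simp_all add: mso_code_ex_U)

lemma computable_cf_formula_code:
  assumes "\<And>j. computable (A j)" "\<And>j. computable (B j)"
  shows "computable (\<lambda>x. cf_formula_code c (\<lambda>j. A j x) (\<lambda>j. B j x))"
  using assms
  by (cases c) (simp_all only: cf_template.simps, (intro computable_pair computable_const computable_ex_U_code; simp)+)

text \<open>The template branches on the operator as a datatype, whereas the computation sees only
  the number of the operator.\<close>

definition cf_formula_dispatch :: "nat \<Rightarrow> (nat \<Rightarrow> nat) \<Rightarrow> (nat \<Rightarrow> nat) \<Rightarrow> nat" where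
  "cf_formula_dispatch k A B = (if k = 0 then cf_formula_code Would A B
     else if k = 1 then cf_formula_code Might A B
     else if k = 2 then cf_formula_code Universal_Would A B
     else cf_formula_code Existential_Might A B)"

lemma cf_formula_dispatch_code: "cf_formula_dispatch (cf_op_code c) A B = cf_formula_code c A B"
  by (cases c) (simp_all only: cf_formula_dispatch_def cf_op_code.simps, simp_all)

lemma computable_cf_mso:
  obtains F where "computable F" "\<And>\<xi>. F (cf_code \<xi>) = mso_code (cf_mso \<xi>)"
proof -
  have "\<forall>j. \<exists>F. computable F \<and> (\<forall>\<psi>. F (qptl_code \<psi>) = mso_code (qptl_at j \<psi>))"
  proof
    fix j
    obtain F where "computable F" "\<And>\<psi>. F (qptl_code \<psi>) = mso_code (qptl_mso (\<lambda>a. \<langle>j, a\<rangle>) \<psi>)"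
      using computable_qptl_mso[of j] by blast
    then show "\<exists>F. computable F \<and> (\<forall>\<psi>. F (qptl_code \<psi>) = mso_code (qptl_at j \<psi>))"
      by (intro exI[of _ F]) (simp add: qptl_at_def)
  qed
  \<comment> \<open>Each \<open>Q j\<close> is computable by itself; only the indices 0 to 4 occur
    in the translation, so uniformity in \<open>j\<close> is no issue.\<close>
  from choice[OF this] obtain Q where Q: "\<And>j. computable (Q j)"
    "\<And>j \<psi>. Q j (qptl_code \<psi>) = mso_code (qptl_at j \<psi>)" by blast
  define or_eq where
    "or_eq j x = MNot_code (MAnd_code (MNot_code (Q j x)) (MNot_code (mso_code (world_eq j 4))))" for j x
  have or_eq: "computable (or_eq j)" for j
    unfolding or_eq_def using Q(1) by (intro computable_pair computable_const) simp
  define H :: "(nat \<Rightarrow> nat) \<Rightarrow> nat \<Rightarrow> nat" where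
    "H r z = (if pfst z = 0 then
        cf_formula_dispatch (pfst (psnd z)) (\<lambda>j. Q j (pfst (psnd (psnd z)))) (\<lambda>j. Q j (psnd (psnd (psnd z))))
      else if pfst z = 1 then
        MAnd_code (cf_formula_dispatch (pfst (psnd z)) (\<lambda>j. Q j (pfst (psnd (psnd z)))) (\<lambda>j. Q j (psnd (psnd (psnd z)))))
          (MNot_code (ex_U_code 4 (MAnd_code (MNot_code (Q 4 (pfst (psnd (psnd z)))))
            (cf_formula_dispatch (pfst (psnd z)) (\<lambda>j. or_eq j (pfst (psnd (psnd z)))) (\<lambda>j. Q j (psnd (psnd (psnd z))))))))
      else if pfst z = 2 then MAnd_code (r (pfst (psnd z))) (r (psnd (psnd z)))
      else if pfst z = 3 then MNot_code (r (psnd z))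
      else Q 0 (psnd z))"
    for r z
  have "computable (\<lambda>z. H (table_lookup (pfst z) (psnd z)) (pfst z))"
    unfolding H_def cf_formula_dispatch_def
    by (intro computable_if computable_eq computable_const computable_pair computable_pfst computable_psnd computable_id
        computable_table_lookup computable_ex_U_code computable_cf_formula_code computable_comp[OF Q(1)] computable_comp[OF or_eq])
  then obtain F where F: "computable F" "\<And>x. F x = H (\<lambda>y. if y < x then F y else 0) x"
    by (rule computable_course_of_values) (rule that, assumption+)
  have "F (cf_code \<xi>) = mso_code (cf_mso \<xi>)" for \<xi>
  proof (induction \<xi>)
    case (Cf c \<phi> \<psi>)
    show ?case
      by (subst F(2)) (simp add: H_def cf_formula_dispatch_code Q mso_code_cf_formula)
  next
    case (Cf_Min c \<phi> \<psi>)
    show ?case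
      by (subst F(2)) (simp add: H_def cf_formula_dispatch_code Q mso_code_cf_formula mso_code_ex_U or_eq_def)
  next
    case (Cf_And \<xi> \<zeta>)
    have "cf_code \<xi> < cf_code (Cf_And \<xi> \<zeta>)" "cf_code \<zeta> < cf_code (Cf_And \<xi> \<zeta>)"
      using pair_ge[of 2 "\<langle>cf_code \<xi>, cf_code \<zeta>\<rangle>"] pair_ge[of "cf_code \<xi>" "cf_code \<zeta>"] by simp_all
    then show ?case using Cf_And by (subst F(2)) (simp add: H_def)
  next
    case (Cf_Not \<xi>)
    have "cf_code \<xi> < cf_code (Cf_Not \<xi>)"
      using pair_ge[of 3 "cf_code \<xi>"] by simp
    then show ?case using Cf_Not by (subst F(2)) (simp add: H_def)
  next
    case (QPTL \<psi>)
    show ?case by (subst F(2)) (simp add: H_def Q)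
  qed
  with F(1) show ?thesis using that by blast
qed

end

section \<open>Lassos\<close>

text \<open>As \<open>f\<close> is total, minimization returns the least zero whenever there is one,
  and at zeros \<open>g\<close> gives the answer. On numbers that code no instance the search may
  diverge.\<close>

lemma decidable_by_search:
  assumes "computable f" "computable g"
    and search: "\<And>x. x \<in> I \<Longrightarrow> \<exists>k. f \<langle>k, code x\<rangle> = 0"
    and result: "\<And>x k. x \<in> I \<Longrightarrow> f \<langle>k, code x\<rangle> = 0 \<Longrightarrow> g \<langle>k, code x\<rangle> = of_bool (P x)"
  shows "decidable I code P"
proof -
  obtain r s where r: "rec_eval r [x, y] (f \<langle>x, y\<rangle>)" and s: "rec_eval s [x, y] (g \<langle>x, y\<rangle>)" for x y
    using assms(1,2)[THEN computable2_uncurry] unfolding computable2_def by blast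
  have "rec_eval (Comp s [Mu r, Proj 0]) [code x] (if P x then 1 else 0)" if x: "x \<in> I" for x
  proof -
    define k where "k = (LEAST k. f \<langle>k, code x\<rangle> = 0)"
    have k: "f \<langle>k, code x\<rangle> = 0"
      unfolding k_def using search[OF x] by (rule LeastI_ex)
    have "rec_eval (Mu r) [code x] k"
    proof (rule mu)
      show "rec_eval r [k, code x] 0"
        using r[of k "code x"] k by simp
      fix m assume "m < k"
      then have "f \<langle>m, code x\<rangle> \<noteq> 0"
        unfolding k_def by (rule not_less_Least)
      then show "\<exists>y. rec_eval r [m, code x] (Suc y)"
        using r[of m "code x"] by (metis not0_implies_Suc)
    qed
    then have "rec_eval (Comp s [Mu r, Proj 0]) [code x] (g \<langle>k, code x\<rangle>)"
      by (rule rec_eval_Comp2[OF _ rec_eval_Proj_0 s])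
    then show ?thesis
      using result[OF x k] by (simp add: of_bool_def)
  qed
  then show ?thesis unfolding decidable_def by blast
qed

text \<open>Propositions of the lasso become variables of world 0, the reference world.\<close>

definition letter :: "nat set \<Rightarrow> nat set" where
  "letter a = (\<lambda>p. \<langle>0, p\<rangle>) ` a"

lemma computable_letter:
  obtains F where "computable F" "\<And>a. finite a \<Longrightarrow> F (set_encode a) = set_encode (letter a)"
proof -
  define F where "F x = set_encode {\<langle>0, i\<rangle> |i. i < x \<and> i \<in> set_decode x}" for x
  have "computable F"
    unfolding F_def by (intro computable_intros)
  moreover have "F (set_encode a) = set_encode (letter a)" if "finite a" for a
  proof -
    have "i < set_encode a" if "i \<in> a" for i
      using set_decode_less[of i "set_encode a"] that \<open>finite a\<close> by simp
    then have "{\<langle>0, i\<rangle> |i. i < set_encode a \<and> i \<in> set_decode (set_encode a)} = letter a"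
      using that by (auto simp: letter_def)
    then show ?thesis by (simp add: F_def)
  qed
  ultimately show ?thesis using that by blast
qed

text \<open>The letters of \<open>u\<close> are multiplied from the left onto the type of a given
  word. With a nonempty \<open>w\<close> this avoids computing the type of the empty word from the
  formula code; hence the period is read as \<open>rotate1 v\<close>, whose last letter starts the
  recursion.\<close>

lemma computable_word_type:
  obtains F where "computable F"
    "\<And>\<phi> u w. \<forall>a\<in>set u. finite a \<Longrightarrow>
       F \<langle>mso_code \<phi>, \<langle>word_code u, word_type \<phi> w\<rangle>\<rangle> = word_type \<phi> (map letter u @ w)"
proof -
  obtain M where M: "computable M" "\<And>\<phi> s t. M \<langle>mso_code \<phi>, \<langle>s, t\<rangle>\<rangle> = type_mult \<phi> s t"
    using computable_type_mult by blast
  obtain T where T: "computable T" "\<And>\<phi> a. finite a \<Longrightarrow> T \<langle>mso_code \<phi>, set_encode a\<rangle> = letter_type \<phi> a"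
    using computable_letter_type by blast
  obtain L where L: "computable L" "\<And>a. finite a \<Longrightarrow> L (set_encode a) = set_encode (letter a)"
    using computable_letter by blast
  define H :: "(nat \<Rightarrow> nat) \<Rightarrow> nat \<Rightarrow> nat" where
    "H r z = (if pfst (psnd z) = 0 then psnd (psnd z)
      else M \<langle>pfst z, \<langle>T \<langle>pfst z, L (pfst (pfst (psnd z) - 1))\<rangle>,
        r \<langle>pfst z, \<langle>psnd (pfst (psnd z) - 1), psnd (psnd z)\<rangle>\<rangle>\<rangle>\<rangle>)"
    for r z
  have "computable (\<lambda>z. H (table_lookup (pfst z) (psnd z)) (pfst z))"
    unfolding H_def
    by (intro computable_intros computable_comp[OF M(1)] computable_comp[OF T(1)] computable_comp[OF L(1)])
  then obtain F where F: "computable F" "\<And>x. F x = H (\<lambda>y. if y < x then F y else 0) x"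
    by (rule computable_course_of_values) (rule that, assumption+)
  have "F \<langle>mso_code \<phi>, \<langle>word_code u, word_type \<phi> w\<rangle>\<rangle> = word_type \<phi> (map letter u @ w)"
    if "\<forall>a\<in>set u. finite a" for \<phi> u w
    using that
  proof (induction u)
    case Nil
    show ?case by (subst F(2)) (simp add: H_def word_code_def)
  next
    case (Cons a u)
    \<comment> \<open>\<open>list_encode\<close> adds one to the pair of head and tail and codes the
      empty list by 0, which explains the subtraction in \<open>H\<close>.\<close>
    have code: "word_code (a # u) = Suc \<langle>set_encode a, word_code u\<rangle>"
      by (simp add: word_code_def)
    have "word_code u < word_code (a # u)"
      using le_prod_encode_2[of "word_code u" "set_encode a"] by (simp add: code)
    then have "\<langle>mso_code \<phi>, \<langle>word_code u, word_type \<phi> w\<rangle>\<rangle> < \<langle>mso_code \<phi>, \<langle>word_code (a # u), word_type \<phi> w\<rangle>\<rangle>"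
      by (intro pair_less add_less_le_mono add_le_less_mono order_refl) simp_all
    moreover have "finite (letter a)"
      using Cons.prems by (simp add: letter_def)
    ultimately show ?case
      using Cons word_type_append[of \<phi> "[letter a]" "map letter u @ w"]
      by (subst F(2)) (simp add: H_def code L T M word_type_single)
  qed
  with F(1) show ?thesis using that by blast
qed

section \<open>Powers of the period and their types\<close>

lemma concat_replicate_Suc: "concat (replicate (Suc k) w) = concat (replicate k w) @ w"
  by (induction k) simp_all

text \<open>The iteration starts at the word itself and counts \<open>Suc k\<close> copies, so no
  empty power occurs.\<close>

lemma word_type_replicate_Suc:
  "word_type \<phi> (concat (replicate (Suc k) w)) = rec_nat (word_type \<phi> w) (\<lambda>_ r. type_mult \<phi> r (word_type \<phi> w)) k"
proof (induction k)
  case (Suc k)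
  then show ?case
    unfolding concat_replicate_Suc[of "Suc k"] by (simp only: word_type_append old.nat.simps(7))
qed simp

text \<open>The lasso \<open>u v\<^sup>\<omega>\<close> is read as \<open>u v\<^sub>0 (rotate1 v)\<^sup>\<omega>\<close>, which makes both of its parts nonempty.\<close>

lemma slice_lasso_prefix:
  assumes "v \<noteq> []"
  shows "slice (\<lambda>n. letter (lasso u v n)) 0 (Suc (length u)) = map letter (u @ [hd v])"
  using assms by (intro nth_equalityI) (auto simp: lasso_def nth_append hd_conv_nth)

text \<open>The cuts lie just after the first letter of the period: offset \<open>m\<close> in a
  block corresponds to offset \<open>Suc m\<close> in \<open>v\<close>, modulo its length.\<close>

lemma slice_lasso_period:
  assumes "v \<noteq> []"
  shows "slice (\<lambda>n. letter (lasso u v n)) (Suc (length u) + i * length v) (Suc (length u) + (i + k) * length v)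
    = concat (replicate k (map letter (rotate1 v)))"
proof (induction k)
  case 0
  show ?case by (simp add: slice_def)
next
  case (Suc k)
  let ?f = "\<lambda>i. Suc (length u) + i * length v"
  have "slice (\<lambda>n. letter (lasso u v n)) (?f (i + k)) (?f (i + Suc k)) = map letter (rotate1 v)"
  proof (rule nth_equalityI)
    fix m assume m: "m < length (slice (\<lambda>n. letter (lasso u v n)) (?f (i + k)) (?f (i + Suc k)))"
    then have "m < length v" by simp
    moreover have "lasso u v (?f (i + k) + m) = v ! (Suc m mod length v)"
    proof -
      have "(?f (i + k) + m - length u) mod length v = (Suc m + (i + k) * length v) mod length v"
        by simp
      also have "\<dots> = Suc m mod length v"
        by (rule mod_mult_self1)
      finally show ?thesis by (simp only: lasso_def) simp
    qed
    ultimately show "slice (\<lambda>n. letter (lasso u v n)) (?f (i + k)) (?f (i + Suc k)) ! m = map letter (rotate1 v) ! m"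
      using m by (simp only: nth_slice length_slice nth_map length_rotate1 nth_rotate1)
  qed simp
  moreover have "slice (\<lambda>n. letter (lasso u v n)) (?f i) (?f (i + Suc k))
      = slice (\<lambda>n. letter (lasso u v n)) (?f i) (?f (i + k)) @ slice (\<lambda>n. letter (lasso u v n)) (?f (i + k)) (?f (i + Suc k))"
    by (intro slice_append) (simp_all add: mult_le_mono1)
  ultimately show ?case
    using Suc by (simp only: concat_replicate_Suc)
qed

text \<open>In a finite semigroup every element has an idempotent power. Here it comes from a Ramsey
  factorization of a periodic word: the type between two cuts is idempotent, and that slice is a
  positive power of the period.\<close>

lemma idempotent_power_exists:
  "\<exists>k. type_mult \<phi> (word_type \<phi> (concat (replicate (Suc k) (map letter v))))
     (word_type \<phi> (concat (replicate (Suc k) (map letter v))))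
   = word_type \<phi> (concat (replicate (Suc k) (map letter v)))"
proof (cases "v = []")
  case True
  then show ?thesis
    using word_type_append[of \<phi> "[]" "[]"] by simp
next
  case False
  \<comment> \<open>The period is rotated back by one step, since the slices of a lasso show it as
    \<open>rotate1\<close>.\<close>
  define v' where "v' = rotate (length v - 1) v"
  have v': "v' \<noteq> []" "rotate1 v' = v"
    using False by (simp_all add: v'_def flip: rotate_Suc)
  let ?\<alpha> = "\<lambda>n. letter (lasso [] v' n)"
  let ?f = "\<lambda>i. Suc (length ([] :: nat set list)) + i * length v'"
  have "strict_mono ?f"
    using v'(1) by (simp add: strict_mono_def)
  then obtain g s e where g: "strict_mono g" and fac: "factorized \<phi> ?\<alpha> (?f \<circ> g) s e"
    by (rule factorized_subsequence)
  have "g 0 < g 1"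
    using g by (simp add: strict_mono_def)
  then obtain k where k: "g 1 = g 0 + Suc k"
    using less_imp_Suc_add by auto
  have "e = word_type \<phi> (slice ?\<alpha> (?f (g 0)) (?f (g 0 + Suc k)))"
    using fac unfolding factorized_def k[symmetric] comp_def by (metis zero_less_one)
  also have "\<dots> = word_type \<phi> (concat (replicate (Suc k) (map letter v)))"
    unfolding slice_lasso_period[OF v'(1)] v'(2) ..
  finally show ?thesis
    using factorized_linked(2)[OF fac] by blast
qed

text \<open>The prefix already ends with one idempotent block, so its type is linked to
  \<open>e\<close> automatically.\<close>

lemma holds_lasso_iff_accepts:
  fixes \<phi> u v k
  defines "e \<equiv> word_type \<phi> (concat (replicate (Suc k) (map letter (rotate1 v))))"
  assumes v: "v \<noteq> []" and idem: "type_mult \<phi> e e = e"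
  shows "holds (tracks (\<lambda>n. letter (lasso u v n))) \<phi> \<longleftrightarrow>
    accepts \<phi> (word_type \<phi> (map letter (u @ [hd v]) @ concat (replicate (Suc k) (map letter (rotate1 v))))) e"
proof (rule holds_iff_accepts)
  let ?\<alpha> = "\<lambda>n. letter (lasso u v n)"
  let ?w = "concat (replicate (Suc k) (map letter (rotate1 v)))"
  let ?f = "\<lambda>i. Suc (length u) + i * length v"
  show "factorized \<phi> ?\<alpha> (\<lambda>i. ?f (Suc i * Suc k)) (word_type \<phi> (map letter (u @ [hd v]) @ ?w)) e"
  proof (rule factorizedI)
    show "strict_mono (\<lambda>i. ?f (Suc i * Suc k))"
      using v by (simp add: strict_mono_def del: mult_Suc mult_Suc_right)
    have "slice ?\<alpha> 0 (?f (Suc k)) = slice ?\<alpha> 0 (?f 0) @ slice ?\<alpha> (?f 0) (?f (0 + Suc k))"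
      by (simp add: slice_append)
    also have "\<dots> = map letter (u @ [hd v]) @ ?w"
      unfolding slice_lasso_period[OF v] using slice_lasso_prefix[OF v, of u] by simp
    finally show "word_type \<phi> (slice ?\<alpha> 0 (?f (Suc 0 * Suc k))) = word_type \<phi> (map letter (u @ [hd v]) @ ?w)"
      by simp
    show "word_type \<phi> (slice ?\<alpha> (?f (Suc i * Suc k)) (?f (Suc (Suc i) * Suc k))) = e" for i
    proof -
      have "Suc (Suc i) * Suc k = Suc i * Suc k + Suc k"
        by simp
      then show ?thesis
        unfolding e_def by (simp only: slice_lasso_period[OF v])
    qed
    show "type_mult \<phi> e e = e"
      by (rule idem)
    \<comment> \<open>The product is regrouped by concatenating words, not by an associativity law
      for \<open>type_mult\<close>.\<close>
    have "type_mult \<phi> (word_type \<phi> (map letter (u @ [hd v]) @ ?w)) e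
        = word_type \<phi> (map letter (u @ [hd v]) @ (?w @ ?w))"
      unfolding e_def by (simp only: word_type_append[symmetric] append_assoc)
    also have "\<dots> = type_mult \<phi> (word_type \<phi> (map letter (u @ [hd v]))) (type_mult \<phi> e e)"
      unfolding e_def by (simp only: word_type_append)
    also have "\<dots> = word_type \<phi> (map letter (u @ [hd v]) @ ?w)"
      unfolding idem unfolding e_def by (simp only: word_type_append)
    finally show "type_mult \<phi> (word_type \<phi> (map letter (u @ [hd v]) @ ?w)) e
        = word_type \<phi> (map letter (u @ [hd v]) @ ?w)" .
  qed
qed

section \<open>The decision procedure\<close>

context qptl_setting
begin

lemma world_tracks_lasso:
  assumes "lasso u v \<in> traces AP"
  shows "world (tracks (\<lambda>n. letter (lasso u v n))) 0 = lasso u v"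
  using assms by (auto simp: world_def tracks_def letter_def traces_def fun_eq_iff)

lemma decidable_trace_checking:
  assumes refl: "\<And>W. W \<in> U \<Longrightarrow> reflp_on U (R W)"
  shows "decidable (trace_checking_instances AP U) instance_code (\<lambda>(u, v, \<xi>). cf_sat U R (lasso u v) \<xi>)"
proof -
  obtain M where M: "computable M" "\<And>\<phi> s t. M \<langle>mso_code \<phi>, \<langle>s, t\<rangle>\<rangle> = type_mult \<phi> s t"
    using computable_type_mult by blast
  obtain T where T: "computable T" "\<And>\<phi> a. finite a \<Longrightarrow> T \<langle>mso_code \<phi>, set_encode a\<rangle> = letter_type \<phi> a"
    using computable_letter_type by blast
  obtain L where L: "computable L" "\<And>a. finite a \<Longrightarrow> L (set_encode a) = set_encode (letter a)"
    using computable_letter by blast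
  obtain A where A: "computable A" "\<And>\<phi> s e. A \<langle>mso_code \<phi>, \<langle>s, e\<rangle>\<rangle> = of_bool (accepts \<phi> s e)"
    using computable_accepts by blast
  obtain W where W: "computable W"
    "\<And>\<phi> u w. \<forall>a\<in>set u. finite a \<Longrightarrow>
       W \<langle>mso_code \<phi>, \<langle>word_code u, word_type \<phi> w\<rangle>\<rangle> = word_type \<phi> (map letter u @ w)"
    using computable_word_type by blast
  obtain C where C: "computable C" "\<And>\<xi>. C (cf_code \<xi>) = mso_code (cf_mso \<xi>)"
    using computable_cf_mso by blast
  \<comment> \<open>An instance code pairs the code of \<open>u\<close> with the pair of the codes
    of \<open>v\<close> and \<open>\<xi>\<close>. As \<open>v\<close> is nonempty its code is a
    successor, and subtracting one exposes head and tail.\<close>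
  define hd_type where "hd_type x = T \<langle>C (psnd (psnd x)), L (pfst (pfst (psnd x) - 1))\<rangle>" for x
  \<comment> \<open>Multiplying the tail onto the type of the head yields the type of
    \<open>tl v @ [hd v]\<close>, the rotated period.\<close>
  define period where "period x = W \<langle>C (psnd (psnd x)), \<langle>psnd (pfst (psnd x) - 1), hd_type x\<rangle>\<rangle>" for x
  define idem where "idem z = rec_nat (period (psnd z))
    (\<lambda>_ r. M \<langle>C (psnd (psnd (psnd z))), \<langle>r, period (psnd z)\<rangle>\<rangle>) (pfst z)" for z
  define f :: "nat \<Rightarrow> nat" where "f z = of_bool (\<not> M \<langle>C (psnd (psnd (psnd z))), \<langle>idem z, idem z\<rangle>\<rangle> = idem z)" for z
  \<comment> \<open>Acceptance is tested on the type of the prefix, the first letter of the period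
    and one idempotent block, linked with the type of that block.\<close>
  define g where "g z = A \<langle>C (psnd (psnd (psnd z))), \<langle>W \<langle>C (psnd (psnd (psnd z))), \<langle>pfst (psnd z),
    M \<langle>C (psnd (psnd (psnd z))), \<langle>hd_type (psnd z), idem z\<rangle>\<rangle>\<rangle>\<rangle>, idem z\<rangle>\<rangle>" for z
  note comps = computable_comp[OF M(1)] computable_comp[OF T(1)] computable_comp[OF L(1)]
    computable_comp[OF A(1)] computable_comp[OF W(1)] computable_comp[OF C(1)]
  have hd_type: "computable hd_type"
    unfolding hd_type_def by (intro computable_intros comps)
  have period: "computable period"
    unfolding period_def by (intro computable_intros comps computable_comp[OF hd_type])
  have idem: "computable idem"
    unfolding idem_def by (intro computable_intros comps computable_comp[OF period])
  have f: "computable f"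
    unfolding f_def by (intro computable_intros comps computable_comp[OF idem])
  have g: "computable g"
    unfolding g_def by (intro computable_intros comps computable_comp[OF hd_type] computable_comp[OF idem])
  have instance_values: "v \<noteq> []" "lasso u v \<in> U" "cf_over AP \<xi>"
    "hd_type (instance_code (u, v, \<xi>)) = word_type (cf_mso \<xi>) [letter (hd v)]"
    "idem \<langle>k, instance_code (u, v, \<xi>)\<rangle>
       = word_type (cf_mso \<xi>) (concat (replicate (Suc k) (map letter (rotate1 v))))"
    "\<forall>a\<in>set u. finite a"
    if x: "(u, v, \<xi>) \<in> trace_checking_instances AP U" for u v \<xi> k
  proof -
    from x have uv: "set u \<subseteq> Pow AP" "set v \<subseteq> Pow AP" "v \<noteq> []"
      by (auto simp: trace_checking_instances_def)
    have fin: "\<forall>a\<in>set w. finite a" if "set w \<subseteq> Pow AP" for w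
      using that finite_AP by (meson PowD finite_subset subsetD)
    show "v \<noteq> []" "lasso u v \<in> U" "cf_over AP \<xi>"
      using x by (auto simp: trace_checking_instances_def)
    show "\<forall>a\<in>set u. finite a" using fin uv by blast
    obtain a v' where v: "v = a # v'" using uv(3) by (cases v) auto
    then have fin': "finite a" "\<forall>b\<in>set v'. finite b" using fin[OF uv(2)] by auto
    have code: "word_code v = Suc \<langle>set_encode a, word_code v'\<rangle>"
      by (simp add: v word_code_def)
    have "finite (letter a)" using fin' by (simp add: letter_def)
    then show hd: "hd_type (instance_code (u, v, \<xi>)) = word_type (cf_mso \<xi>) [letter (hd v)]"
      using fin' by (simp add: hd_type_def code C L T v[symmetric] word_type_single) (simp add: v)
    have period: "period (instance_code (u, v, \<xi>)) = word_type (cf_mso \<xi>) (map letter (rotate1 v))"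
      unfolding period_def hd using W(2)[OF fin'(2), of "cf_mso \<xi>" "[letter a]"] by (simp add: code C) (simp add: v)
    show "idem \<langle>k, instance_code (u, v, \<xi>)\<rangle>
       = word_type (cf_mso \<xi>) (concat (replicate (Suc k) (map letter (rotate1 v))))"
      unfolding word_type_replicate_Suc idem_def psnd_pair pfst_pair period by (simp add: C M)
  qed
  show ?thesis
  proof (rule decidable_by_search[OF f g])
    fix x assume "x \<in> trace_checking_instances AP U"
    moreover obtain u v \<xi> where x: "x = (u, v, \<xi>)" by (cases x)
    ultimately have inst: "(u, v, \<xi>) \<in> trace_checking_instances AP U" by simp
    note vals = instance_values[OF inst]
    let ?w = "\<lambda>k. concat (replicate (Suc k) (map letter (rotate1 v)))"
    have code: "C (psnd (psnd (instance_code x))) = mso_code (cf_mso \<xi>)"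
      by (simp add: x C)
    have f_iff: "f \<langle>k, instance_code x\<rangle> = 0 \<longleftrightarrow>
        type_mult (cf_mso \<xi>) (word_type (cf_mso \<xi>) (?w k)) (word_type (cf_mso \<xi>) (?w k))
        = word_type (cf_mso \<xi>) (?w k)" for k
      unfolding f_def psnd_pair code using vals(5)[of k] by (simp add: M x del: instance_code.simps replicate_Suc)
    show "\<exists>k. f \<langle>k, instance_code x\<rangle> = 0"
      unfolding f_iff by (rule idempotent_power_exists)
    fix k assume k: "f \<langle>k, instance_code x\<rangle> = 0"
    have "M \<langle>mso_code (cf_mso \<xi>), \<langle>hd_type (instance_code x), idem \<langle>k, instance_code x\<rangle>\<rangle>\<rangle>
        = word_type (cf_mso \<xi>) ([letter (hd v)] @ ?w k)"
      unfolding x vals(4) vals(5) M word_type_append ..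
    moreover have "pfst (instance_code x) = word_code u"
      by (simp add: x)
    ultimately have "g \<langle>k, instance_code x\<rangle>
        = of_bool (accepts (cf_mso \<xi>) (word_type (cf_mso \<xi>) (map letter u @ [letter (hd v)] @ ?w k))
           (word_type (cf_mso \<xi>) (?w k)))"
      unfolding g_def psnd_pair code using vals(5)[of k] W(2)[OF vals(6)]
      by (simp only: A x)
    also have "\<dots> = of_bool (holds (tracks (\<lambda>n. letter (lasso u v n))) (cf_mso \<xi>))"
      using holds_lasso_iff_accepts[OF vals(1), of "cf_mso \<xi>" k u] k
      unfolding f_iff by (simp only: map_append list.map append_assoc)
    also have "\<dots> = of_bool (cf_sat U R (lasso u v) \<xi>)"
    proof -
      have "world (tracks (\<lambda>n. letter (lasso u v n))) 0 = lasso u v"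
        using vals(2) by (intro world_tracks_lasso) (simp add: U_def language_def)
      then show ?thesis
        using holds_cf_mso[OF vals(3), of "tracks (\<lambda>n. letter (lasso u v n))"] refl[OF vals(2)] by simp
    qed
    finally show "g \<langle>k, instance_code x\<rangle> = of_bool (case x of (u, v, \<xi>) \<Rightarrow> cf_sat U R (lasso u v) \<xi>)"
      by (simp add: x)
  qed
qed

end

theorem theorem16:
  fixes AP :: "nat set"
    and U :: "nat trace set"
    and R :: "nat trace \<Rightarrow> nat trace \<Rightarrow> nat trace \<Rightarrow> bool"
  assumes "finite AP"
    and "\<exists>\<phi>\<^sub>U. qptl_over AP \<phi>\<^sub>U \<and> U = language AP \<phi>\<^sub>U"
    and "R \<in> qptl_similarities AP"
    and "\<forall>W\<in>U. preorder_with_minimum U (R W) W"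
  shows "decidable (trace_checking_instances AP U) instance_code
           (\<lambda>(u, v, \<xi>). cf_sat U R (lasso u v) \<xi>)"
proof -
  obtain \<phi>\<^sub>U where U: "qptl_over AP \<phi>\<^sub>U" "U = language AP \<phi>\<^sub>U"
    using assms(2) by blast
  obtain \<phi>\<^sub>R where R: "qptl_over (AP \<times> {1, 2, 3}) \<phi>\<^sub>R"
    "\<forall>t1\<in>traces AP. \<forall>t2\<in>traces AP. \<forall>t3\<in>traces AP. R t1 t2 t3 \<longleftrightarrow> qptl_sat (trace_union3 t1 t2 t3) \<phi>\<^sub>R"
    using assms(3) unfolding qptl_similarities_def by blast
  interpret qptl_setting AP \<phi>\<^sub>U \<phi>\<^sub>R R
    using assms(1) U(1) R by unfold_locales blast+
  have "U = qptl_setting.U AP \<phi>\<^sub>U"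
    using U(2) U_def by simp
  then show ?thesis
    using decidable_trace_checking assms(4) by (simp add: preorder_with_minimum_def)
qed

end
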